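(* Suppose that assumptions (A)–(E) below hold. Then \begin{align*} \sup_{\lambda^\star\in\Lambda_n^\star}\mathsf{P}_{\lambda^\star}^{(n)}\Big[\hat\Xi_n\big(d_n(T_n(\theta),\lambda^\star)\ge A_n\sqrt{L_n}\,\epsilon_{n}\big)\Big]=o(1) \end{align*} for any diverging sequence $A_n\to\infty$.
   Context: Setting: for each $n$, $Y^{(n)}\in\mathfrak{Y}_n$ ($\sigma$-finite $\mu_n$), natural parameter space $\Lambda_n$ with metric $d_n$, likelihood $q_n:\Lambda_n\times\mathfrak{Y}_n\to(0,\infty)$, $\mathsf{P}^{(n)}_\lambda(dy)=q_n(\lambda,y)\mu_n(dy)$. Countable model index set $\mathcal{M}_n$, parameter spaces $\Theta_{n,m}$, $\Theta_{n,\mathcal{M}_n}=\cup_m\Theta_{n,m}$, map $T_n:\Theta_{n,\mathcal{M}_n}\to\Lambda_n$. Prior $\Pi_n=\sum_m\alpha_{n,m}\Pi_{n,m}$, $\Pi_{n,m}\in\mathbb{P}(\Theta_{n,m})$, posterior $\Pi_n(\cdot\mid Y^{(n)})\propto q_n(T_n(\theta),Y^{(n)})\Pi_n(d\theta)$. Variational family $\mathbb{V}_n=\{\sum_m\gamma_m\Xi_m:(\gamma_m)\text{ probability vector},\ \Xi_m\in\mathbb{V}_{n,m}\}$ with $\mathbb{V}_{n,m}\subset\mathbb{P}(\Theta_{n,m})$, and $\hat\Xi_n\in\arg\min_{\Xi\in\mathbb{V}_n}\mathrm{KL}(\Xi,\Pi_n(\cdot\mid Y^{(n)}))$. $\mathsf{D}_\rho(\mathsf{P}_1,\mathsf{P}_2)=\frac{1}{\rho-1}\log\int(d\mathsf{P}_1/d\mathsf{P}_2)^{\rho-1}d\mathsf{P}_1$;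 $\mathcal{N}(u,S,d_n)$ is the $u$-covering number of $S$ w.r.t. $(\theta,\theta')\mapsto d_n(T_n(\theta),T_n(\theta'))$. (A) Constants $\rho_\circ\in(0,1)$, $\rho_{+}>1$, $a_2\ge a_1$, $c_2\ge c_1>0$ with $a_1+c_1nd_n^2(\lambda_0,\lambda_1)\le\mathsf{D}_{\rho_\circ}(\mathsf{P}^{(n)}_{\lambda_0},\mathsf{P}^{(n)}_{\lambda_1})$ and $\mathsf{D}_{\rho_{+}}(\mathsf{P}^{(n)}_{\lambda_0},\mathsf{P}^{(n)}_{\lambda_1})\le a_2+c_2nd_n^2(\lambda_0,\lambda_1)$ for all $\lambda_0,\lambda_1\in\Lambda_n$, large $n$. (B) For true spaces $\Lambda_n^\star\subset\Lambda_n$ there are positive $\eta_{n,m},\zeta_{n,m}$: for every $\lambda^\star\in\Lambda_n^\star$, $m$, some $\theta^*_{n,m}(\lambda^\star)\in\Theta_{n,m}$ has $d_n(T_n(\theta^*_{n,m}(\lambda^\star)),\lambda^\star)\le\eta_{n,m}$; and for each $u>0$ some $c(u)$ gives $\sup_{\zeta>\zeta_{n,m}}\log\mathcal{N}(u\zeta,\{\theta\in\Theta_{n,m}:d_n(T_n(\theta),\lambda^\star)\le2\zeta\},d_n)\le c(u)n\zeta_{n,m}^2$ for all $\lambda^\star\in\Lambda_n^\star$, $m$, large $n$. (C) $\epsilon_n:=\inf_m(\eta_{n,m}+\zeta_{n,m})$ satisfies $n\epsilon_n^2\to\infty$, and constants $c_1,c_2,c_3>0$ give $\sum_{m:\zeta_{n,m}\ge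 H'\epsilon_n}e^{-L'n\zeta_{n,m}^2}\le e^{(c_1-L'(H')^2)n\epsilon_n^2}$ and $\sum_{m:\zeta_{n,m}<H'\epsilon_n}e^{L''n\zeta_{n,m}^2}\le e^{(c_2+c_3L''(H')^2)n\epsilon_n^2}$ for large $n$, all $H'>1$, $L',L''>0$. (D) $\alpha_{n,m}\propto e^{-b_0L_nn\zeta_{n,m}^2}$ ($b_0>0$, $L_n\ge1$); some $c>0$ gives $\Pi_{n,m}(d_n(T_n(\theta),\lambda^\star)\le\eta_{n,m}+\zeta_{n,m})\ge e^{-cn\zeta_{n,m}^2}$ for all $\lambda^\star\in\Lambda_n^\star$, $m$, large $n$; $\Pi_n$ is independent of $Y^{(n)}$. (E) Some $c>0$ gives $\sup_{\lambda^\star\in\Lambda_n^\star}\mathsf{P}^{(n)}_{\lambda^\star}[\inf_{\Xi\in\mathbb{V}_n}\mathrm{KL}(\Xi,\Pi_n(\cdot\mid Y^{(n)}))]\le cL_nn\epsilon_n^2$ for large $n$. *)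

theory Defs
  imports "HOL-Probability.Probability"
begin

definition KL_div :: "'a measure \<Rightarrow> 'a measure \<Rightarrow> ereal" where
  "KL_div M N =
     (if sets M = sets N \<and> absolutely_continuous N M then
        (let f = (\<lambda>x. enn2real (RN_deriv N M x)) in
          enn2ereal (\<integral>\<^sup>+ x. ennreal (max 0 (ln (f x))) \<partial>M)
          - enn2ereal (\<integral>\<^sup>+ x. ennreal (max 0 (- ln (f x))) \<partial>M))
      else \<infinity>)"

definition renyi_div :: "real \<Rightarrow> 'a measure \<Rightarrow> 'a measure \<Rightarrow> ereal" where
  "renyi_div \<rho> P1 P2 =
     (if sets P1 = sets P2 \<and> absolutely_continuous P2 P1 then
        (let I = (\<integral>\<^sup>+ x. ennreal (enn2real (RN_deriv P2 P1 x) powr (\<rho> - 1)) \<partial>P1) in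
          if I = \<infinity> then (if \<rho> > 1 then \<infinity> else - \<infinity>)
          else ereal (ln (enn2real I) / (\<rho> - 1)))
      else \<infinity>)"

text \<open>u-covering number of S w.r.t. the pseudo-distance dist: minimal number of
  closed dist-balls of radius u with centres in S covering S (infinity if none).\<close>
definition covering_number :: "real \<Rightarrow> 'a set \<Rightarrow> ('a \<Rightarrow> 'a \<Rightarrow> real) \<Rightarrow> enat" where
  "covering_number u S dd =
     Inf {enat (card F) | F. finite F \<and> F \<subseteq> S \<and> (\<forall>x\<in>S. \<exists>c\<in>F. dd c x \<le> u)}"

definition mixture :: "'b measure \<Rightarrow> 'm set \<Rightarrow> ('m \<Rightarrow> real) \<Rightarrow> ('m \<Rightarrow> 'b measure) \<Rightarrow> 'b measure" where
  "mixture S I w P = measure_of (space S) (sets S)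
      (\<lambda>A. \<integral>\<^sup>+ m. ennreal (w m) * emeasure (P m) A \<partial>count_space I)"

definition prior_weight :: "real \<Rightarrow> real \<Rightarrow> nat \<Rightarrow> 'm set \<Rightarrow> ('m \<Rightarrow> real) \<Rightarrow> 'm \<Rightarrow> real" where
  "prior_weight b0 Lfac n I \<zeta> m =
     exp (- b0 * Lfac * real n * (\<zeta> m)\<^sup>2)
     / enn2real (\<integral>\<^sup>+ m'. ennreal (exp (- b0 * Lfac * real n * (\<zeta> m')\<^sup>2)) \<partial>count_space I)"

definition posterior :: "'b measure \<Rightarrow> ('b \<Rightarrow> 'y \<Rightarrow> real) \<Rightarrow> 'y \<Rightarrow> 'b measure" where
  "posterior Pr lik y = density Pr
      (\<lambda>\<theta>. ennreal (lik \<theta> y) / (\<integral>\<^sup>+ \<theta>'. ennreal (lik \<theta>' y) \<partial>Pr))"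

definition var_family :: "'b measure \<Rightarrow> 'm set \<Rightarrow> ('m \<Rightarrow> 'b measure set) \<Rightarrow> 'b measure set" where
  "var_family S I V = {mixture S I \<gamma> \<Xi> | \<gamma> \<Xi>.
      (\<forall>m\<in>I. 0 \<le> \<gamma> m) \<and> (\<integral>\<^sup>+ m. ennreal (\<gamma> m) \<partial>count_space I) = 1 \<and> (\<forall>m\<in>I. \<Xi> m \<in> V m)}"

end

theory Submission
  imports Defs
begin

text \<open>
  Write \<open>x = n \<epsilon>\<^sub>n\<^sup>2\<close>. The Donsker--Varadhan inequality for the test function \<open>t 1\<^sub>U\<close> gives
  \<open>t \<Xi>(U) \<le> KL(\<Xi>, \<Pi>(\<cdot>|Y)) + ln 2\<close> whenever \<open>\<Pi>(U|Y) \<le> exp (- t)\<close>. With \<open>t = K L x\<close> and (E), the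
  expected variational mass of \<open>U\<close> is at most \<open>P(\<Pi>(U|Y) > exp (- K L x)) + O(1 / K)\<close>. So it is enough
  that for every \<open>K\<close> there is an \<open>H\<close> such that, for \<open>U = {d \<ge> H sqrt L \<epsilon>}\<close>, this probability vanishes
  uniformly in the truth. Since \<open>H\<close> stays fixed while \<open>n\<close> grows, (C) is only needed for fixed constants.

  The tail of the posterior is controlled by the usual three ingredients. The evidence is bounded
  from below by the contribution of a model with \<open>\<eta> + \<zeta> < 2 \<epsilon>\<close>, using the divergence of order
  \<open>\<rho>\<^sub>+\<close> and Markov's inequality. Models with \<open>\<zeta> \<ge> G \<epsilon>\<close> have negligible prior mass. On the other models
  a union of likelihood ratio tests over coverings of shells separates the truth from \<open>U\<close>: the
  divergence of order \<open>\<rho>\<^sub>0\<close> bounds the errors at the centres, and the one of order \<open>\<rho>\<^sub>+\<close> transfers the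
  error of the second kind from a centre to its ball.
\<close>

section \<open>Variational inequality and mixtures\<close>

text \<open>The weights of the prior contain the factor \<open>L n\<close>, which may change with
  \<open>n\<close>, while (C) is available only for multipliers that stay fixed along the sequence.
  So (C) is invoked for the weights at the multiplier \<open>b0\<close>, and the surplus
  \<open>L n - 1\<close> is pulled out of the sums pointwise. The evidence and the bound in (E) both
  cost an exponent of order \<open>L n * x\<close>; the factor \<open>sqrt (L n)\<close> in the
  radius makes the tests win on this scale.

  The constants have to be chosen without a circle. The relative covering radius \<open>u\<close>
  and the rates \<open>v\<close> and \<open>\<kappa>\<close> depend on (A) alone, so the constant of
  (B) for this \<open>u\<close> is known before the accuracy \<open>e\<close> is given. Then
  \<open>e\<close> fixes \<open>K\<close>, \<open>K\<close> fixes the cut \<open>G\<close> between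
  small and large models, \<open>G\<close> fixes the total size of the coverings, and
  \<open>H\<close> comes last, large enough to beat that size and the loss in the evidence.

  The posterior is a probability measure only for almost every \<open>y\<close>; this suffices,
  because it enters through integrals against the laws \<open>P n l\<close>.\<close>

lemma KL_div_ge:
  fixes t :: real
  assumes "prob_space M" "prob_space N" and U: "U \<in> sets N"
    and small: "emeasure N U \<le> ennreal (exp (- t))" and "t \<ge> 0"
  shows "ennreal t * emeasure M U \<le> e2ennreal (KL_div M N) + ennreal (ln 2)"
proof (cases "sets M = sets N \<and> absolutely_continuous N M")
  case False
  then show ?thesis by (simp add: KL_div_def del: de_Morgan_conj)
next
  case True
  then have sets: "sets M = sets N" and ac: "absolutely_continuous N M" by auto
  interpret M: prob_space M by fact
  interpret N: prob_space N by fact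
  have sp: "space M = space N" by (rule sets_eq_imp_space_eq) fact
  have UM: "U \<in> sets M" using U sets by simp
  define f where "f = RN_deriv N M"
  have f_meas[measurable]: "f \<in> borel_measurable N" unfolding f_def by simp
  have f_measM[measurable]: "f \<in> borel_measurable M"
    using f_meas sets by (simp cong: measurable_cong_sets)
  have dens: "density N f = M" unfolding f_def using ac sets by (simp add: N.density_RN_deriv)
  have "AE x in N. f x \<noteq> \<infinity>" unfolding f_def
    by (rule N.RN_deriv_finite[OF M.sigma_finite_measure ac]) (simp add: sets)
  then have "AE x in density N f. f x \<noteq> \<infinity> \<and> f x \<noteq> 0"
    by (subst AE_density) auto
  then have AE_f: "AE x in M. f x \<noteq> \<infinity> \<and> f x \<noteq> 0" unfolding dens .
  define F where "F x = enn2real (f x)" for x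
  \<comment> \<open>Donsker--Varadhan normalises \<open>exp (t * indicator U x)\<close> by its
    \<open>N\<close>-integral. That integral is at most \<open>2\<close> since
    \<open>emeasure N U\<close> is at most \<open>exp (- t)\<close>, so dividing by \<open>2\<close>
    suffices; this is the origin of the term \<open>ln 2\<close>.\<close>
  define h where "h x = exp (t * indicator U x) / 2" for x :: 'a
  have [measurable]: "U \<in> sets N" "U \<in> sets M" by fact+
  have F_meas[measurable]: "F \<in> borel_measurable M" "F \<in> borel_measurable N"
    unfolding F_def by measurable
  have h_meas[measurable]: "h \<in> borel_measurable M" "h \<in> borel_measurable N"
    unfolding h_def by measurable
  define a where "a = (\<integral>\<^sup>+ x. ennreal (max 0 (ln (F x))) \<partial>M)"
  define b where "b = (\<integral>\<^sup>+ x. ennreal (max 0 (- ln (F x))) \<partial>M)"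
  have KL: "KL_div M N = enn2ereal a - enn2ereal b"
    unfolding KL_div_def a_def b_def F_def f_def Let_def using True by simp
  \<comment> \<open>This is \<open>ln s \<le> s - 1\<close> at \<open>s = h x / F x\<close>, with
    every negative term moved to the other side, so that the integration in \<open>ennreal\<close>
    involves no subtraction.\<close>
  have pointwise: "AE x in M. ennreal t * indicator U x + 1 + ennreal (max 0 (- ln (F x)))
      \<le> ennreal (max 0 (ln (F x))) + ennreal (ln 2) + ennreal (h x / F x)"
    using AE_f
  proof eventually_elim
    case (elim x)
    then have F: "F x > 0" unfolding F_def
      by (simp add: enn2real_positive_iff less_top zero_less_iff_neq_zero)
    have h: "h x > 0" by (simp add: h_def)
    have "ln (h x / F x) \<le> h x / F x - 1" using F h by (intro ln_le_minus_one) simp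
    moreover have "ln (h x / F x) = t * indicator U x - ln 2 - ln (F x)"
      using F h by (subst ln_div) (simp_all add: h_def ln_div)
    ultimately have *: "t * indicator U x + 1 + max 0 (- ln (F x))
        \<le> max 0 (ln (F x)) + ln 2 + h x / F x"
      by (simp add: max_def)
    have "ennreal t * indicator U x + 1 + ennreal (max 0 (- ln (F x)))
       = ennreal (t * indicator U x + 1 + max 0 (- ln (F x)))"
      using \<open>t \<ge> 0\<close> by (auto simp: indicator_def)
    also have "\<dots> \<le> ennreal (max 0 (ln (F x)) + ln 2 + h x / F x)"
      using * by (rule ennreal_leI)
    also have "\<dots> = ennreal (max 0 (ln (F x))) + ennreal (ln 2) + ennreal (h x / F x)"
      using F h by simp
    finally show ?case .
  qed
  have "(\<integral>\<^sup>+x. ennreal t * indicator U x + 1 + ennreal (max 0 (- ln (F x))) \<partial>M)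
      \<le> (\<integral>\<^sup>+x. ennreal (max 0 (ln (F x))) + ennreal (ln 2) + ennreal (h x / F x) \<partial>M)"
    by (rule nn_integral_mono_AE) fact
  then have main: "ennreal t * emeasure M U + 1 + b
      \<le> a + ennreal (ln 2) + (\<integral>\<^sup>+x. ennreal (h x / F x) \<partial>M)"
    unfolding a_def b_def by (simp add: nn_integral_add nn_integral_cmult M.emeasure_space_1)
  have "(\<integral>\<^sup>+x. ennreal (h x / F x) \<partial>M) = (\<integral>\<^sup>+x. ennreal (h x / F x) \<partial>density N f)"
    by (simp add: dens)
  also have "\<dots> = (\<integral>\<^sup>+x. f x * ennreal (h x / F x) \<partial>N)"
    by (rule nn_integral_density) measurable
  also have "\<dots> \<le> (\<integral>\<^sup>+x. ennreal (1/2) + ennreal (exp t / 2) * indicator U x \<partial>N)"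
  proof (rule nn_integral_mono_AE)
    show "AE x in N. f x * ennreal (h x / F x)
        \<le> ennreal (1/2) + ennreal (exp t / 2) * indicator U x"
      using \<open>AE x in N. f x \<noteq> \<infinity>\<close>
    proof eventually_elim
      case (elim x)
      have fF: "f x = ennreal (F x)" unfolding F_def using elim by (simp add: less_top)
      have "F x \<ge> 0" by (simp add: F_def)
      have "f x * ennreal (h x / F x) = ennreal (F x * (h x / F x))"
        unfolding fF using \<open>F x \<ge> 0\<close> by (intro ennreal_mult[symmetric]) (auto simp: h_def)
      \<comment> \<open>Equality where \<open>F x > 0\<close>; where \<open>F x = 0\<close> the
        quotient is \<open>0\<close> by convention and the inequality persists.\<close>
      also have "\<dots> \<le> ennreal (h x)" by (intro ennreal_leI) (simp add: h_def)
      also have "\<dots> \<le> ennreal (1/2) + ennreal (exp t / 2) * indicator U x"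
        by (auto simp: h_def indicator_def intro: add_increasing)
      finally show ?case .
    qed
  qed
  also have "\<dots> = ennreal (1/2) + ennreal (exp t / 2) * emeasure N U"
    by (subst nn_integral_add) (auto simp: nn_integral_cmult N.emeasure_space_1)
  also have "\<dots> \<le> ennreal (1/2) + ennreal (exp t / 2) * ennreal (exp (- t))"
    by (intro add_left_mono mult_left_mono small) simp
  also have "\<dots> = ennreal (1/2 + exp t / 2 * exp (- t))"
    by (subst ennreal_mult[symmetric], simp, simp, subst ennreal_plus[symmetric]) simp_all
  also have "\<dots> = 1"
    by (simp add: exp_minus)
  finally have "ennreal t * emeasure M U + 1 + b \<le> a + ennreal (ln 2) + 1"
    using main by (meson add_left_mono order_trans)
  then have "1 + (ennreal t * emeasure M U + b) \<le> 1 + (a + ennreal (ln 2))"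
    by (simp add: ac_simps)
  then have fin: "ennreal t * emeasure M U + b \<le> a + ennreal (ln 2)"
    by (rule ennreal_add_left_cancel_le[THEN iffD1, THEN disjE]) auto
  show ?thesis
  proof (cases "a = \<infinity>")
    case True
    then show ?thesis unfolding KL by simp
  next
    case a: False
    have tM: "ennreal t * emeasure M U \<noteq> \<infinity>" by (simp add: ennreal_mult_eq_top_iff)
    \<comment> \<open>Once \<open>a\<close> is finite the integrated inequality bounds
      \<open>b\<close>, so \<open>KL_div M N\<close> is a genuine difference of reals, which
      \<open>e2ennreal\<close> truncates at \<open>0\<close>.\<close>
    have b: "b \<noteq> \<infinity>"
      using fin a by (auto simp: top_unique)
    obtain a' where a': "a = ennreal a'" "a' \<ge> 0" using a by (cases a) auto
    obtain b' where b': "b = ennreal b'" "b' \<ge> 0" using b by (cases b) auto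
    obtain c' where c': "ennreal t * emeasure M U = ennreal c'" "c' \<ge> 0"
      using tM by (cases "ennreal t * emeasure M U") auto
    have "c' + b' \<le> a' + ln 2"
      using fin a' b' c' by (simp add: ennreal_plus[symmetric] del: ennreal_plus)
    then have "ennreal c' \<le> ennreal (max 0 (a' - b') + ln 2)"
      by (intro ennreal_leI) (simp add: max_def)
    also have "\<dots> = ennreal (a' - b') + ennreal (ln 2)"
      by (cases "a' - b' \<ge> 0") (simp_all add: max_def ennreal_neg)
    finally show ?thesis unfolding KL a' b' c' using a' b' by simp
  qed
qed

section \<open>Mixtures over a countable set of models\<close>

lemma sets_mixture [simp]: "sets (mixture S I w P) = sets S"
  by (simp add: mixture_def sets.sigma_sets_eq)

lemma space_mixture [simp]: "space (mixture S I w P) = space S"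
  by (simp add: mixture_def)

lemma emeasure_mixture:
  assumes I: "countable I" and P: "\<And>m. m \<in> I \<Longrightarrow> sets (P m) = sets S" and A: "A \<in> sets S"
  shows "emeasure (mixture S I w P) A
    = (\<integral>\<^sup>+ m. ennreal (w m) * emeasure (P m) A \<partial>count_space I)"
  unfolding mixture_def
proof (rule emeasure_measure_of_sigma)
  show "sigma_algebra (space S) (sets S)" ..
  show "positive (sets S) (\<lambda>A. \<integral>\<^sup>+ m. ennreal (w m) * emeasure (P m) A \<partial>count_space I)"
    by (simp add: positive_def)
  show "countably_additive (sets S) (\<lambda>A. \<integral>\<^sup>+ m. ennreal (w m) * emeasure (P m) A \<partial>count_space I)"
  proof (rule countably_additiveI)
    fix B :: "nat \<Rightarrow> 'b set" assume B: "range B \<subseteq> sets S" "disjoint_family B"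
    have "(\<Sum>i. \<integral>\<^sup>+ m. ennreal (w m) * emeasure (P m) (B i) \<partial>count_space I)
        = (\<integral>\<^sup>+ m. (\<Sum>i. ennreal (w m) * emeasure (P m) (B i)) \<partial>count_space I)"
      by (rule nn_integral_suminf[symmetric]) simp
    also have "\<dots> = (\<integral>\<^sup>+ m. ennreal (w m) * emeasure (P m) (\<Union>i. B i) \<partial>count_space I)"
      using B P by (intro nn_integral_cong) (auto simp: suminf_emeasure)
    finally show "(\<Sum>i. \<integral>\<^sup>+ m. ennreal (w m) * emeasure (P m) (B i) \<partial>count_space I)
        = (\<integral>\<^sup>+ m. ennreal (w m) * emeasure (P m) (\<Union>i. B i) \<partial>count_space I)" .
  qed
qed fact

text \<open>Induction from indicators to monotone limits; each step commutes with integration over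
  the counting measure. It reduces prior integrals to integrals over single models.\<close>

lemma nn_integral_mixture:
  assumes I: "countable I" and P: "\<And>m. m \<in> I \<Longrightarrow> sets (P m) = sets S"
    and f: "f \<in> borel_measurable S"
  shows "(\<integral>\<^sup>+ x. f x \<partial>mixture S I w P)
    = (\<integral>\<^sup>+ m. ennreal (w m) * (\<integral>\<^sup>+ x. f x \<partial>P m) \<partial>count_space I)"
proof -
  have meas: "g \<in> borel_measurable (P m)" if "g \<in> borel_measurable S" "m \<in> I"
    for g :: "'b \<Rightarrow> ennreal" and m
    using that P by (simp cong: measurable_cong_sets)
  have measX: "g \<in> borel_measurable (mixture S I w P)" if "g \<in> borel_measurable S"
    for g :: "'b \<Rightarrow> ennreal"
    using that by (simp cong: measurable_cong_sets)
  show ?thesis using f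
  proof (induction rule: borel_measurable_induct)
    case (cong f g)
    have "(\<integral>\<^sup>+ x. f x \<partial>mixture S I w P) = (\<integral>\<^sup>+ x. g x \<partial>mixture S I w P)"
      by (rule nn_integral_cong) (simp add: cong)
    moreover have "(\<integral>\<^sup>+ x. f x \<partial>P m) = (\<integral>\<^sup>+ x. g x \<partial>P m)" if "m \<in> I" for m
      by (rule nn_integral_cong) (use cong sets_eq_imp_space_eq[OF P[OF that]] in simp)
    then have "(\<integral>\<^sup>+ m. ennreal (w m) * (\<integral>\<^sup>+ x. f x \<partial>P m) \<partial>count_space I)
       = (\<integral>\<^sup>+ m. ennreal (w m) * (\<integral>\<^sup>+ x. g x \<partial>P m) \<partial>count_space I)"
      by (intro nn_integral_cong) simp
    ultimately show ?case using cong by simp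
  next
    case (set A)
    then show ?case using P
      by (simp add: emeasure_mixture[OF I] cong: nn_integral_cong_simp)
  next
    case (mult u c)
    have "(\<integral>\<^sup>+ m. ennreal (w m) * (\<integral>\<^sup>+ x. c * u x \<partial>P m) \<partial>count_space I)
        = (\<integral>\<^sup>+ m. c * (ennreal (w m) * (\<integral>\<^sup>+ x. u x \<partial>P m)) \<partial>count_space I)"
      by (intro nn_integral_cong) (simp add: nn_integral_cmult meas mult ac_simps)
    then show ?case using mult by (simp add: nn_integral_cmult measX)
  next
    case (add u v)
    have "(\<integral>\<^sup>+ m. ennreal (w m) * (\<integral>\<^sup>+ x. v x + u x \<partial>P m) \<partial>count_space I)
        = (\<integral>\<^sup>+ m. ennreal (w m) * (\<integral>\<^sup>+ x. v x \<partial>P m) + ennreal (w m) * (\<integral>\<^sup>+ x. u x \<partial>P m) \<partial>count_space I)"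
      by (intro nn_integral_cong) (simp add: nn_integral_add meas add distrib_left)
    then show ?case using add by (simp add: nn_integral_add measX)
  next
    case (seq U)
    have "(\<integral>\<^sup>+ x. (SUP i. U i) x \<partial>mixture S I w P) = (SUP i. \<integral>\<^sup>+ x. U i x \<partial>mixture S I w P)"
      using nn_integral_monotone_convergence_SUP[of U "mixture S I w P"] seq by (simp add: measX image_comp)
    also have "\<dots> = (SUP i. \<integral>\<^sup>+ m. ennreal (w m) * (\<integral>\<^sup>+ x. U i x \<partial>P m) \<partial>count_space I)"
      using seq by simp
    also have "\<dots> = (\<integral>\<^sup>+ m. (SUP i. ennreal (w m) * (\<integral>\<^sup>+ x. U i x \<partial>P m)) \<partial>count_space I)"
      using \<open>incseq U\<close>
      by (intro nn_integral_monotone_convergence_SUP[symmetric])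
        (auto simp: incseq_def le_fun_def intro!: mult_left_mono nn_integral_mono)
    also have "\<dots> = (\<integral>\<^sup>+ m. ennreal (w m) * (\<integral>\<^sup>+ x. (SUP i. U i) x \<partial>P m) \<partial>count_space I)"
    proof (rule nn_integral_cong)
      fix m assume "m \<in> space (count_space I)"
      then have "(\<integral>\<^sup>+ x. (SUP i. U i) x \<partial>P m) = (SUP i. \<integral>\<^sup>+ x. U i x \<partial>P m)"
        using nn_integral_monotone_convergence_SUP[of U "P m"] seq by (simp add: meas image_comp)
      then show "(SUP i. ennreal (w m) * (\<integral>\<^sup>+ x. U i x \<partial>P m)) = ennreal (w m) * (\<integral>\<^sup>+ x. (SUP i. U i) x \<partial>P m)"
        by (simp add: SUP_mult_left_ennreal)
    qed
    finally show ?case .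
  qed
qed

lemma prob_space_mixture:
  assumes I: "countable I" and P: "\<And>m. m \<in> I \<Longrightarrow> sets (P m) = sets S"
    and "\<And>m. m \<in> I \<Longrightarrow> prob_space (P m)"
    and w: "(\<integral>\<^sup>+ m. ennreal (w m) \<partial>count_space I) = 1"
  shows "prob_space (mixture S I w P)"
proof
  have "emeasure (mixture S I w P) (space (mixture S I w P))
      = (\<integral>\<^sup>+ m. ennreal (w m) * emeasure (P m) (space S) \<partial>count_space I)"
    using I P by (simp add: emeasure_mixture)
  also have "\<dots> = (\<integral>\<^sup>+ m. ennreal (w m) \<partial>count_space I)"
    using assms(3) P
    by (intro nn_integral_cong) (simp add: prob_space.emeasure_space_1 flip: sets_eq_imp_space_eq[OF P])
  finally show "emeasure (mixture S I w P) (space (mixture S I w P)) = 1" using w by simp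
qed

section \<open>Renyi divergences and likelihood ratio tests\<close>

locale positive_density_pair = sigma_finite_measure \<mu> for \<mu> :: "'y measure" +
  fixes p q :: "'y \<Rightarrow> real"
  assumes p_meas [measurable]: "p \<in> borel_measurable \<mu>"
    and q_meas [measurable]: "q \<in> borel_measurable \<mu>"
    and p_pos: "\<And>y. y \<in> space \<mu> \<Longrightarrow> p y > 0"
    and q_pos: "\<And>y. y \<in> space \<mu> \<Longrightarrow> q y > 0"
    and p_prob: "prob_space (density \<mu> (\<lambda>y. ennreal (p y)))"
    and q_prob: "prob_space (density \<mu> (\<lambda>y. ennreal (q y)))"
begin

abbreviation "Pp \<equiv> density \<mu> (\<lambda>y. ennreal (p y))"
abbreviation "Pq \<equiv> density \<mu> (\<lambda>y. ennreal (q y))"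

text \<open>For \<open>r = \<rho> - 1\<close> this is the exponential of \<open>(\<rho> - 1)\<close>
  times the Renyi divergence of order \<open>\<rho>\<close>; for \<open>0 < \<rho> < 1\<close> it is
  the affinity, the integral of \<open>p powr \<rho> * q powr (1 - \<rho>)\<close>. It takes values
  in \<open>ennreal\<close> because it may be infinite for \<open>r > 0\<close>.\<close>

definition "power_integral r = (\<integral>\<^sup>+ y. ennreal ((p y / q y) powr r) \<partial>Pp)"

lemma Pp_eq: "density Pq (\<lambda>y. ennreal (p y / q y)) = Pp"
proof -
  have "density Pq (\<lambda>y. ennreal (p y / q y)) = density \<mu> (\<lambda>y. ennreal (q y) * ennreal (p y / q y))"
    by (rule density_density_eq) measurable
  also have "\<dots> = Pp"
  proof (rule density_cong)
    show "AE y in \<mu>. ennreal (q y) * ennreal (p y / q y) = ennreal (p y)"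
      using p_pos q_pos by (intro AE_I2) (simp add: less_imp_le less_imp_neq[symmetric] flip: ennreal_mult)
  qed measurable
  finally show ?thesis .
qed

text \<open>The derivative is determined only up to null sets of \<open>Pq\<close>; positivity of
  \<open>q\<close> carries the identity over to \<open>\<mu>\<close>, and from there it passes to
  \<open>Pp\<close>.\<close>

lemma RN_deriv_pair: "AE y in Pp. enn2real (RN_deriv Pq Pp y) = p y / q y"
proof -
  interpret Q: prob_space Pq by (rule q_prob)
  have "AE y in Pq. ennreal (p y / q y) = RN_deriv Pq Pp y"
    by (rule Q.RN_deriv_unique[OF _ Pp_eq]) measurable
  then have "AE y in \<mu>. ennreal (p y / q y) = RN_deriv Pq Pp y"
    using q_pos by (subst (asm) AE_density) (auto elim!: AE_mp intro!: AE_I2)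
  then have "AE y in \<mu>. enn2real (RN_deriv Pq Pp y) = p y / q y"
    using AE_space
  proof eventually_elim
    case (elim y)
    then show ?case using p_pos[of y] q_pos[of y] by (simp flip: elim(1))
  qed
  then have "AE y in \<mu>. 0 < ennreal (p y) \<longrightarrow> enn2real (RN_deriv Pq Pp y) = p y / q y"
    by eventually_elim simp
  then show ?thesis
    by (subst AE_density) auto
qed

lemma renyi_div_pair:
  "renyi_div \<rho> Pp Pq =
    (if power_integral (\<rho> - 1) = \<infinity> then (if \<rho> > 1 then \<infinity> else - \<infinity>)
     else ereal (ln (enn2real (power_integral (\<rho> - 1))) / (\<rho> - 1)))"
proof -
  have "absolutely_continuous Pq Pp"
    by (subst Pp_eq[symmetric], rule absolutely_continuousI_density) measurable
  moreover have "(\<integral>\<^sup>+ x. ennreal (enn2real (RN_deriv Pq Pp x) powr (\<rho> - 1)) \<partial>Pp) = power_integral (\<rho> - 1)"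
    unfolding power_integral_def
    by (rule nn_integral_cong_AE) (use RN_deriv_pair in eventually_elim, simp)
  ultimately show ?thesis by (simp add: renyi_div_def Let_def)
qed

lemma power_integral_pos: "power_integral r \<noteq> 0"
proof
  interpret prob_space Pp by (rule p_prob)
  assume "power_integral r = 0"
  then have "AE y in Pp. ennreal ((p y / q y) powr r) = 0"
    unfolding power_integral_def by (subst (asm) nn_integral_0_iff_AE) auto
  moreover have "AE y in Pp. ennreal ((p y / q y) powr r) \<noteq> 0"
    using p_pos q_pos by (intro AE_I2) (force simp: ennreal_eq_0_iff)
  ultimately have "AE y in Pp. False" by eventually_elim simp
  then show False by simp
qed

text \<open>Multiplication by \<open>\<rho> - 1\<close> reverses inequalities for
  \<open>\<rho> < 1\<close>, so a lower bound at an order below one and an upper bound at an order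
  above one both bound the integral from above. Either of them also excludes an infinite
  integral.\<close>

lemma power_integral_le:
  assumes "\<rho> > 1 \<and> renyi_div \<rho> Pp Pq \<le> ereal D \<or> \<rho> < 1 \<and> ereal D \<le> renyi_div \<rho> Pp Pq"
  shows "power_integral (\<rho> - 1) \<le> ennreal (exp ((\<rho> - 1) * D))"
proof -
  have "power_integral (\<rho> - 1) \<noteq> \<infinity>"
    using assms by (auto simp: renyi_div_pair)
  then obtain i where i: "power_integral (\<rho> - 1) = ennreal i" "i \<ge> 0"
    by (cases "power_integral (\<rho> - 1)") auto
  with power_integral_pos[of "\<rho> - 1"] have "i > 0" by (cases "i = 0") auto
  have "renyi_div \<rho> Pp Pq = ereal (ln i / (\<rho> - 1))"
    using i by (simp add: renyi_div_pair)
  with assms have "ln i \<le> (\<rho> - 1) * D"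
    by (auto simp: field_simps)
  then have "i \<le> exp ((\<rho> - 1) * D)"
    using \<open>i > 0\<close> by (metis exp_le_cancel_iff exp_ln)
  then show ?thesis unfolding i by (rule ennreal_leI)
qed

text \<open>Markov's inequality for \<open>(p / q) powr r\<close> at the level
  \<open>exp (r * v)\<close>.\<close>

lemma density_ratio_tail:
  assumes "r > 0"
  shows "emeasure Pp {y \<in> space \<mu>. exp v * q y \<le> p y} \<le> ennreal (exp (- r * v)) * power_integral r"
proof -
  have "emeasure Pp {y \<in> space \<mu>. exp v * q y \<le> p y}
      = (\<integral>\<^sup>+ y. indicator {y \<in> space \<mu>. exp v * q y \<le> p y} y \<partial>Pp)"
    by (simp add: nn_integral_indicator)
  also have "\<dots> \<le> (\<integral>\<^sup>+ y. ennreal (exp (- r * v)) * ennreal ((p y / q y) powr r) \<partial>Pp)"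
  proof (rule nn_integral_mono)
    fix y assume "y \<in> space Pp"
    then have y: "p y > 0" "q y > 0" using p_pos q_pos by auto
    show "indicator {y \<in> space \<mu>. exp v * q y \<le> p y} y
        \<le> ennreal (exp (- r * v)) * ennreal ((p y / q y) powr r)"
    proof (cases "exp v * q y \<le> p y")
      case True
      then have "exp v \<le> p y / q y" using y by (simp add: field_simps)
      then have "(exp v) powr r \<le> (p y / q y) powr r"
        using \<open>r > 0\<close> by (intro powr_mono2) auto
      then have "exp (- r * v) * exp (r * v) \<le> exp (- r * v) * (p y / q y) powr r"
        by (intro mult_left_mono) (auto simp: exp_powr_real mult.commute)
      then have "1 \<le> exp (- r * v) * (p y / q y) powr r"
        by (simp flip: exp_add)
      then have "1 \<le> ennreal (exp (- r * v) * (p y / q y) powr r)"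
        by (metis ennreal_1 ennreal_leI)
      then show ?thesis by (auto simp: indicator_def ennreal_mult)
    qed auto
  qed
  also have "\<dots> = ennreal (exp (- r * v)) * power_integral r"
    unfolding power_integral_def by (rule nn_integral_cmult) measurable
  finally show ?thesis .
qed

text \<open>Truncation of \<open>p / q\<close> at \<open>exp v\<close>, used in place of Hoelder's inequality.\<close>

lemma emeasure_le_change_of_density:
  assumes "r > 0" and A [measurable]: "A \<in> sets \<mu>"
  shows "emeasure Pp A \<le> ennreal (exp (- r * v)) * power_integral r + ennreal (exp v) * emeasure Pq A"
proof -
  let ?E = "{y \<in> space \<mu>. exp v * q y \<le> p y}"
  have "emeasure Pp A \<le> emeasure Pp (?E \<union> (A - ?E))"
    by (intro emeasure_mono) auto
  also have "\<dots> \<le> emeasure Pp ?E + emeasure Pp (A - ?E)"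
    by (intro emeasure_subadditive) auto
  also have "emeasure Pp (A - ?E) \<le> ennreal (exp v) * emeasure Pq A"
  proof -
    have "emeasure Pp (A - ?E) = (\<integral>\<^sup>+ y. ennreal (p y) * indicator (A - ?E) y \<partial>\<mu>)"
      by (subst emeasure_density) auto
    also have "\<dots> \<le> (\<integral>\<^sup>+ y. ennreal (exp v) * (ennreal (q y) * indicator A y) \<partial>\<mu>)"
      using q_pos by (intro nn_integral_mono)
        (auto simp: indicator_def ennreal_mult[symmetric] less_imp_le intro!: ennreal_leI)
    also have "\<dots> = ennreal (exp v) * emeasure Pq A"
      by (subst nn_integral_cmult) (auto simp: emeasure_density)
    finally show ?thesis .
  qed
  finally show ?thesis
    using density_ratio_tail[OF \<open>r > 0\<close>, of v] by (auto intro: order_trans add_mono)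
qed

text \<open>On the region \<open>p y \<le> q y\<close> the integrand
  \<open>(p y / q y) powr (- r)\<close> is at least one.\<close>

lemma likelihood_ratio_error_first:
  assumes "r > 0"
  shows "emeasure Pp {y \<in> space \<mu>. p y \<le> q y} \<le> power_integral (- r)"
proof -
  have "emeasure Pp {y \<in> space \<mu>. p y \<le> q y} = (\<integral>\<^sup>+ y. indicator {y \<in> space \<mu>. p y \<le> q y} y \<partial>Pp)"
    by simp
  also have "\<dots> \<le> power_integral (- r)"
    unfolding power_integral_def
  proof (rule nn_integral_mono)
    fix y assume "y \<in> space Pp"
    then have y: "p y > 0" "q y > 0" using p_pos q_pos by auto
    have "1 \<le> (p y / q y) powr - r" if "p y \<le> q y"
    proof -
      have "1 powr r \<le> (q y / p y) powr r"
        using that y \<open>r > 0\<close> by (intro powr_mono2) auto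
      also have "\<dots> = (p y / q y) powr - r"
        using y by (simp add: powr_minus powr_divide)
      finally show ?thesis by simp
    qed
    then show "indicator {y \<in> space \<mu>. p y \<le> q y} y \<le> ennreal ((p y / q y) powr - r)"
      by (auto simp: indicator_def simp flip: ennreal_1 intro: ennreal_leI)
  qed
  finally show ?thesis .
qed

text \<open>On the region \<open>q y \<le> p y\<close>, the density
  \<open>q y = p y * (p y / q y) powr (- 1)\<close> is at most
  \<open>p y * (p y / q y) powr (- r)\<close> because \<open>r < 1\<close>. Both errors are thus
  controlled by the same integral, and one ordered pair in the lower bound of (A) serves for
  both.\<close>

lemma likelihood_ratio_error_second:
  assumes "0 < r" "r < 1"
  shows "emeasure Pq {y \<in> space \<mu>. q y \<le> p y} \<le> power_integral (- r)"
proof -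
  have "emeasure Pq {y \<in> space \<mu>. q y \<le> p y}
      = (\<integral>\<^sup>+ y. ennreal (q y) * indicator {y \<in> space \<mu>. q y \<le> p y} y \<partial>\<mu>)"
    by (simp add: emeasure_density)
  also have "\<dots> \<le> (\<integral>\<^sup>+ y. ennreal (p y) * ennreal ((p y / q y) powr - r) \<partial>\<mu>)"
  proof (rule nn_integral_mono)
    fix y assume "y \<in> space \<mu>"
    then have y: "p y > 0" "q y > 0" using p_pos q_pos by auto
    have "q y \<le> p y * (p y / q y) powr - r" if "q y \<le> p y"
    proof -
      have "1 \<le> p y / q y" using that y by simp
      then have "(p y / q y) powr (- 1) \<le> (p y / q y) powr (- r)"
        using \<open>r < 1\<close> by (intro powr_mono) auto
      then have "p y * (p y / q y) powr (- 1) \<le> p y * (p y / q y) powr (- r)"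
        using y by (intro mult_left_mono) auto
      then show ?thesis using y by (simp add: powr_minus)
    qed
    then show "ennreal (q y) * indicator {y \<in> space \<mu>. q y \<le> p y} y
        \<le> ennreal (p y) * ennreal ((p y / q y) powr - r)"
      using y by (auto simp: indicator_def less_imp_le simp flip: ennreal_mult intro!: ennreal_leI)
  qed
  also have "\<dots> = power_integral (- r)"
    unfolding power_integral_def by (subst nn_integral_density) auto
  finally show ?thesis .
qed

end

section \<open>Bayesian model averaging\<close>

text \<open>The union bound, with the sum over models written as an integral for the counting
  measure, the form in which (C) bounds such sums.\<close>

lemma emeasure_UN_le_nn_integral:
  assumes I: "countable I" and A [measurable]: "\<And>i. i \<in> I \<Longrightarrow> A i \<in> sets M"
  shows "emeasure M (\<Union>i\<in>I. A i) \<le> (\<integral>\<^sup>+ i. emeasure M (A i) \<partial>count_space I)"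
proof -
  have "(\<Union>i\<in>I. A i) \<in> sets M" using I by (intro sets.countable_UN'') auto
  then have "emeasure M (\<Union>i\<in>I. A i) = (\<integral>\<^sup>+ x. indicator (\<Union>i\<in>I. A i) x \<partial>M)"
    by simp
  also have "\<dots> \<le> (\<integral>\<^sup>+ x. (\<integral>\<^sup>+ i. indicator (A i) x \<partial>count_space I) \<partial>M)"
  proof (rule nn_integral_mono)
    fix x
    show "indicator (\<Union>i\<in>I. A i) x \<le> (\<integral>\<^sup>+ i. indicator (A i) x \<partial>count_space I)"
    proof (cases "x \<in> (\<Union>i\<in>I. A i)")
      case True
      then obtain i where "i \<in> I" "x \<in> A i" by auto
      then show ?thesis
        using nn_integral_ge_point[of i I "\<lambda>i. indicator (A i) x"] by (auto simp: indicator_def)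
    qed simp
  qed
  also have "\<dots> = (\<integral>\<^sup>+ i. emeasure M (A i) \<partial>count_space I)"
    using I by (subst nn_integral_count_space_nn_integral) (auto intro!: nn_integral_cong)
  finally show ?thesis .
qed

text \<open>One fixed sample size, with weights of total mass one; the estimates obtained here are
  non-asymptotic, and limits enter only in the final theorem. Joint measurability of the likelihood
  is what Fubini's theorem requires.\<close>

locale mixture_model = sigma_finite_measure \<mu> for \<mu> :: "'y measure" +
  fixes \<Lambda> :: "'l set" and q :: "'l \<Rightarrow> 'y \<Rightarrow> real"
    and I :: "'m set" and S :: "'t measure" and \<Theta> :: "'m \<Rightarrow> 't set" and T :: "'t \<Rightarrow> 'l"
    and Q :: "'m \<Rightarrow> 't measure" and w :: "'m \<Rightarrow> real"
  assumes q_pos: "\<And>l y. l \<in> \<Lambda> \<Longrightarrow> y \<in> space \<mu> \<Longrightarrow> q l y > 0"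
    and q_meas [measurable]: "\<And>l. l \<in> \<Lambda> \<Longrightarrow> q l \<in> borel_measurable \<mu>"
    and P_prob: "\<And>l. l \<in> \<Lambda> \<Longrightarrow> prob_space (density \<mu> (\<lambda>y. ennreal (q l y)))"
    and I_countable: "countable I"
    and \<Theta>_sets: "\<And>m. m \<in> I \<Longrightarrow> \<Theta> m \<in> sets S"
    and T_range: "\<And>m \<theta>. m \<in> I \<Longrightarrow> \<theta> \<in> \<Theta> m \<Longrightarrow> T \<theta> \<in> \<Lambda>"
    and lik_meas: "(\<lambda>(\<theta>, y). q (T \<theta>) y) \<in> borel_measurable (S \<Otimes>\<^sub>M \<mu>)"
    and Q_prob: "\<And>m. m \<in> I \<Longrightarrow> prob_space (Q m)"
    and Q_sets: "\<And>m. m \<in> I \<Longrightarrow> sets (Q m) = sets S"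
    and Q_\<Theta>: "\<And>m. m \<in> I \<Longrightarrow> emeasure (Q m) (\<Theta> m) = 1"
    and w_sum: "(\<integral>\<^sup>+ m. ennreal (w m) \<partial>count_space I) = 1"
begin

section \<open>Evidence and posterior\<close>

abbreviation "P l \<equiv> density \<mu> (\<lambda>y. ennreal (q l y))"
abbreviation "prior \<equiv> mixture S I w Q"

text \<open>The unnormalised posterior mass of \<open>U\<close>; at \<open>U = space S\<close> it is
  the marginal likelihood of \<open>y\<close>.\<close>

definition "evidence U y = (\<integral>\<^sup>+ \<theta>. ennreal (q (T \<theta>) y) * indicator U \<theta> \<partial>prior)"

abbreviation "post \<equiv> posterior prior (\<lambda>\<theta> y. q (T \<theta>) y)"

lemma prior_prob: "prob_space prior"
  by (rule prob_space_mixture[OF I_countable Q_sets Q_prob w_sum])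

lemma positive_density_pairI:
  "l \<in> \<Lambda> \<Longrightarrow> l' \<in> \<Lambda> \<Longrightarrow> positive_density_pair \<mu> (q l) (q l')"
  using q_pos q_meas P_prob sigma_finite_measure_axioms
  by (auto simp: positive_density_pair_def positive_density_pair_axioms_def)

lemma Q_AE: "m \<in> I \<Longrightarrow> AE \<theta> in Q m. \<theta> \<in> \<Theta> m"
  using \<Theta>_sets[of m] Q_prob[of m] Q_\<Theta>[of m] Q_sets[of m]
  by (intro prob_space.AE_prob_1) (auto simp: measure_def)

text \<open>The likelihood is known to be positive and normalised only at parameters in some
  \<open>\<Theta> m\<close>; elsewhere \<open>T \<theta>\<close> may leave \<open>\<Lambda>\<close>.
  Statements about the prior are therefore made almost everywhere.\<close>

lemma prior_AE: "AE \<theta> in prior. \<theta> \<in> (\<Union>m\<in>I. \<Theta> m)"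
proof -
  interpret prior: prob_space prior by (rule prior_prob)
  have sets: "(\<Union>m\<in>I. \<Theta> m) \<in> sets S"
    using I_countable \<Theta>_sets by (intro sets.countable_UN'') auto
  have "emeasure prior (\<Union>m\<in>I. \<Theta> m) = (\<integral>\<^sup>+ m. ennreal (w m) * emeasure (Q m) (\<Union>m\<in>I. \<Theta> m) \<partial>count_space I)"
    by (rule emeasure_mixture[OF I_countable Q_sets sets])
  also have "\<dots> = (\<integral>\<^sup>+ m. ennreal (w m) \<partial>count_space I)"
  proof (rule nn_integral_cong)
    fix m assume "m \<in> space (count_space I)"
    then have m: "m \<in> I" by simp
    have "emeasure (Q m) (\<Theta> m) \<le> emeasure (Q m) (\<Union>m\<in>I. \<Theta> m)"
      using m sets Q_sets by (intro emeasure_mono) auto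
    moreover have "emeasure (Q m) (\<Union>m\<in>I. \<Theta> m) \<le> 1"
      using Q_prob[OF m] by (rule prob_space.measure_le_1)
    ultimately have "emeasure (Q m) (\<Union>m\<in>I. \<Theta> m) = 1"
      using Q_\<Theta>[OF m] by simp
    then show "ennreal (w m) * emeasure (Q m) (\<Union>m\<in>I. \<Theta> m) = ennreal (w m)" by simp
  qed
  finally show ?thesis
    using w_sum sets by (intro prior.AE_prob_1) (auto simp: measure_def)
qed

lemma lik_meas_ennreal [measurable]:
  "(\<lambda>x. ennreal (q (T (fst x)) (snd x))) \<in> borel_measurable (S \<Otimes>\<^sub>M \<mu>)"
  using measurable_compose[OF lik_meas measurable_ennreal] by (simp add: split_beta')

lemma lik_meas_snd [measurable]: "\<theta> \<in> space S \<Longrightarrow> q (T \<theta>) \<in> borel_measurable \<mu>"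
  using measurable_compose_Pair1[OF _ lik_meas, of \<theta>] by simp

text \<open>Turns unnormalised posterior mass, integrated over the data in \<open>F\<close>, into an
  average of probabilities of \<open>F\<close>. This is how the error probabilities of a test enter
  the bounds for the posterior.\<close>

lemma Fubini_lik:
  assumes "sets N = sets S" "sigma_finite_measure N" "U \<in> sets S" "F \<in> sets \<mu>"
  shows "(\<integral>\<^sup>+ y. (\<integral>\<^sup>+ \<theta>. ennreal (q (T \<theta>) y) * indicator U \<theta> \<partial>N) * indicator F y \<partial>\<mu>)
    = (\<integral>\<^sup>+ \<theta>. emeasure (P (T \<theta>)) F * indicator U \<theta> \<partial>N)"
proof -
  interpret N: sigma_finite_measure N by fact
  interpret pair_sigma_finite N \<mu> ..
  note [measurable] = assms(3,4)
  have [measurable_cong]: "sets N = sets S" by fact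
  have spN: "space N = space S" by (rule sets_eq_imp_space_eq) fact
  have lik1: "(\<lambda>\<theta>. ennreal (q (T \<theta>) y) * indicator U \<theta>) \<in> borel_measurable N" if "y \<in> space \<mu>" for y
  proof -
    have "(\<lambda>\<theta>. ennreal (q (T \<theta>) y)) \<in> borel_measurable N"
      using measurable_Pair1[OF lik_meas_ennreal that] by (simp cong: measurable_cong_sets)
    then show ?thesis by measurable
  qed
  have "(\<integral>\<^sup>+ y. (\<integral>\<^sup>+ \<theta>. ennreal (q (T \<theta>) y) * indicator U \<theta> \<partial>N) * indicator F y \<partial>\<mu>)
      = (\<integral>\<^sup>+ y. (\<integral>\<^sup>+ \<theta>. ennreal (q (T \<theta>) y) * indicator U \<theta> * indicator F y \<partial>N) \<partial>\<mu>)"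
    by (intro nn_integral_cong nn_integral_multc[symmetric] lik1)
  also have "\<dots> = (\<integral>\<^sup>+ \<theta>. (\<integral>\<^sup>+ y. ennreal (q (T \<theta>) y) * indicator U \<theta> * indicator F y \<partial>\<mu>) \<partial>N)"
    by (rule Fubini') (simp add: split_beta', measurable)
  also have "\<dots> = (\<integral>\<^sup>+ \<theta>. emeasure (P (T \<theta>)) F * indicator U \<theta> \<partial>N)"
  proof (rule nn_integral_cong)
    fix \<theta> assume "\<theta> \<in> space N"
    then have [measurable]: "q (T \<theta>) \<in> borel_measurable \<mu>" using spN by (intro lik_meas_snd) simp
    have "(\<integral>\<^sup>+ y. ennreal (q (T \<theta>) y) * indicator U \<theta> * indicator F y \<partial>\<mu>)
        = (\<integral>\<^sup>+ y. ennreal (q (T \<theta>) y) * indicator F y * indicator U \<theta> \<partial>\<mu>)"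
      by (simp add: ac_simps)
    also have "\<dots> = emeasure (P (T \<theta>)) F * indicator U \<theta>"
      by (subst nn_integral_multc) (auto simp: emeasure_density)
    finally show "(\<integral>\<^sup>+ y. ennreal (q (T \<theta>) y) * indicator U \<theta> * indicator F y \<partial>\<mu>)
        = emeasure (P (T \<theta>)) F * indicator U \<theta>" .
  qed
  finally show ?thesis .
qed

lemma lik_meas_fst: "y \<in> space \<mu> \<Longrightarrow> (\<lambda>\<theta>. ennreal (q (T \<theta>) y)) \<in> borel_measurable S"
  using measurable_Pair1[OF lik_meas_ennreal] by simp

lemma evidence_meas [measurable]:
  assumes [measurable]: "U \<in> sets S"
  shows "evidence U \<in> borel_measurable \<mu>"
proof -
  interpret prior: prob_space prior by (rule prior_prob)
  have "(\<lambda>(y, \<theta>). ennreal (q (T \<theta>) y) * indicator U \<theta>) \<in> borel_measurable (\<mu> \<Otimes>\<^sub>M S)"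
  proof -
    have "(\<lambda>x. ennreal (q (T (snd x)) (fst x))) \<in> borel_measurable (\<mu> \<Otimes>\<^sub>M S)"
      using measurable_pair_swap[OF lik_meas_ennreal] by (simp add: split_beta')
    then show ?thesis unfolding split_beta' by measurable
  qed
  moreover have "sets (\<mu> \<Otimes>\<^sub>M prior) = sets (\<mu> \<Otimes>\<^sub>M S)"
    by (intro sets_pair_measure_cong) auto
  ultimately have "(\<lambda>(y, \<theta>). ennreal (q (T \<theta>) y) * indicator U \<theta>) \<in> borel_measurable (\<mu> \<Otimes>\<^sub>M prior)"
    by (simp cong: measurable_cong_sets)
  then show ?thesis unfolding evidence_def by (rule prior.borel_measurable_nn_integral)
qed

lemma evidence_pos:
  assumes y: "y \<in> space \<mu>"
  shows "evidence (space S) y \<noteq> 0"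
proof
  interpret prior: prob_space prior by (rule prior_prob)
  have [measurable]: "(\<lambda>\<theta>. ennreal (q (T \<theta>) y)) \<in> borel_measurable prior"
    using lik_meas_fst[OF y] by (simp cong: measurable_cong_sets)
  have [measurable]: "space S \<in> sets prior" by simp
  assume "evidence (space S) y = 0"
  then have "AE \<theta> in prior. ennreal (q (T \<theta>) y) * indicator (space S) \<theta> = 0"
    unfolding evidence_def by (subst (asm) nn_integral_0_iff_AE) auto
  then have "AE \<theta> in prior. False"
    using prior_AE AE_space
  proof eventually_elim
    case (elim \<theta>)
    then have "T \<theta> \<in> \<Lambda>" using T_range by auto
    then show ?case using q_pos[of "T \<theta>" y] y elim by (simp add: ennreal_eq_0_iff)
  qed
  then show False by simp
qed

text \<open>By Fubini the marginal likelihood has integral at most one. This leaves room for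
  infinite values on a null set, and there \<open>posterior\<close> is no probability
  measure.\<close>

lemma evidence_finite: "AE y in \<mu>. evidence (space S) y \<noteq> \<infinity>"
proof (rule nn_integral_noteq_infinite)
  interpret prior: prob_space prior by (rule prior_prob)
  have "(\<integral>\<^sup>+ y. evidence (space S) y \<partial>\<mu>) = (\<integral>\<^sup>+ y. evidence (space S) y * indicator (space \<mu>) y \<partial>\<mu>)"
    by (intro nn_integral_cong) simp
  also have "\<dots> = (\<integral>\<^sup>+ \<theta>. emeasure (P (T \<theta>)) (space \<mu>) * indicator (space S) \<theta> \<partial>prior)"
    unfolding evidence_def by (rule Fubini_lik) (auto simp: prior.sigma_finite_measure_axioms)
  also have "\<dots> \<le> (\<integral>\<^sup>+ \<theta>. 1 \<partial>prior)"
  proof (rule nn_integral_mono_AE)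
    show "AE \<theta> in prior. emeasure (P (T \<theta>)) (space \<mu>) * indicator (space S) \<theta> \<le> 1"
      using prior_AE
    proof eventually_elim
      case (elim \<theta>)
      then have "T \<theta> \<in> \<Lambda>" using T_range by auto
      from prob_space.emeasure_space_1[OF P_prob[OF this]] show ?case by (simp add: indicator_def)
    qed
  qed
  also have "\<dots> = 1" using prior.emeasure_space_1 by simp
  finally show "(\<integral>\<^sup>+ y. evidence (space S) y \<partial>\<mu>) \<noteq> \<infinity>"
    by (auto simp: top_unique)
qed simp

lemma sets_post [simp]: "sets (post y) = sets S"
  by (simp add: posterior_def)

lemma emeasure_post:
  assumes y: "y \<in> space \<mu>" and U: "U \<in> sets S"
  shows "emeasure (post y) U = evidence U y / evidence (space S) y"
proof -
  have [measurable]: "(\<lambda>\<theta>. ennreal (q (T \<theta>) y)) \<in> borel_measurable prior"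
    using lik_meas_fst[OF y] by (simp cong: measurable_cong_sets)
  have *: "(\<integral>\<^sup>+ \<theta>. ennreal (q (T \<theta>) y) \<partial>prior) = evidence (space S) y"
    unfolding evidence_def by (intro nn_integral_cong) simp
  have [measurable]: "U \<in> sets prior" using U by simp
  have "emeasure (post y) U
      = (\<integral>\<^sup>+ \<theta>. ennreal (q (T \<theta>) y) / evidence (space S) y * indicator U \<theta> \<partial>prior)"
    unfolding posterior_def * by (rule emeasure_density) measurable
  also have "\<dots> = (\<integral>\<^sup>+ \<theta>. (ennreal (q (T \<theta>) y) * indicator U \<theta>) / evidence (space S) y \<partial>prior)"
    by (simp add: divide_ennreal_def ac_simps)
  also have "\<dots> = evidence U y / evidence (space S) y"
    unfolding evidence_def by (rule nn_integral_divide) measurable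
  finally show ?thesis .
qed

lemma prob_space_post: "AE y in \<mu>. prob_space (post y)"
  using evidence_finite AE_space
proof eventually_elim
  case (elim y)
  have "space (post y) = space S" by (simp add: posterior_def)
  then have "emeasure (post y) (space (post y)) = 1"
    using elim evidence_pos[of y]
    by (subst \<open>space (post y) = space S\<close>, subst emeasure_post)
      (auto intro!: ennreal_divide_self simp: top.not_eq_extremum)
  then show ?case by (rule prob_spaceI)
qed

section \<open>Posterior tail and lower bound for the evidence\<close>

lemma posterior_tail:
  fixes t c :: real
  assumes l: "l \<in> \<Lambda>" and U: "U \<in> sets S" and F: "F \<in> sets \<mu>" and "c > 0"
  shows "emeasure (P l) {y \<in> space \<mu>. ennreal (exp (- t)) < emeasure (post y) U}
    \<le> emeasure (P l) {y \<in> space \<mu>. evidence (space S) y < ennreal (c * q l y)} + emeasure (P l) F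
      + ennreal (exp t / c) * (\<integral>\<^sup>+ \<theta>. emeasure (P (T \<theta>)) (space \<mu> - F) * indicator U \<theta> \<partial>prior)"
    (is "emeasure _ ?A \<le> emeasure _ ?B + _ + ?R")
    and "{y \<in> space \<mu>. ennreal (exp (- t)) < emeasure (post y) U} \<in> sets \<mu>"
proof -
  interpret prior: prob_space prior by (rule prior_prob)
  note [measurable] = U F
  have [measurable]: "q l \<in> borel_measurable \<mu>" by (rule q_meas[OF l])
  have A_eq: "?A = {y \<in> space \<mu>. ennreal (exp (- t)) < evidence U y / evidence (space S) y}"
    using emeasure_post[OF _ U] by auto
  show A[measurable]: "?A \<in> sets \<mu>" unfolding A_eq by measurable
  have B[measurable]: "?B \<in> sets \<mu>" by measurable
  \<comment> \<open>On this set Bayes' formula bounds \<open>q l y\<close> by a multiple of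
    \<open>evidence U y\<close>, so its probability under \<open>P l\<close> is dominated by an
    integral of the evidence, to which \<open>Fubini_lik\<close> applies.\<close>
  let ?C = "?A - (?B \<union> F)"
  have "emeasure (P l) ?A \<le> emeasure (P l) (?B \<union> F \<union> ?C)"
    by (intro emeasure_mono) auto
  also have "\<dots> \<le> emeasure (P l) (?B \<union> F) + emeasure (P l) ?C"
    by (intro emeasure_subadditive) auto
  also have "\<dots> \<le> emeasure (P l) ?B + emeasure (P l) F + emeasure (P l) ?C"
    by (intro add_mono emeasure_subadditive) auto
  also have "emeasure (P l) ?C \<le> ?R"
  proof -
    have "emeasure (P l) ?C = (\<integral>\<^sup>+ y. ennreal (q l y) * indicator ?C y \<partial>\<mu>)"
      by (rule emeasure_density) auto
    also have "\<dots> \<le> (\<integral>\<^sup>+ y. ennreal (exp t / c) * (evidence U y * indicator (space \<mu> - F) y) \<partial>\<mu>)"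
    proof (rule nn_integral_mono)
      fix y assume "y \<in> space \<mu>"
      show "ennreal (q l y) * indicator ?C y
          \<le> ennreal (exp t / c) * (evidence U y * indicator (space \<mu> - F) y)"
      proof (cases "y \<in> ?C")
        case True
        then have y: "y \<in> space \<mu>" "y \<notin> F"
          and *: "ennreal (exp (- t)) < evidence U y / evidence (space S) y"
          and **: "ennreal (c * q l y) \<le> evidence (space S) y"
          by (auto simp: A_eq)
        have q: "q l y > 0" using q_pos l y by simp
        have "ennreal (q l y) = ennreal (exp t / c) * (ennreal (exp (- t)) * ennreal (c * q l y))"
          using \<open>c > 0\<close> q by (simp add: ennreal_mult[symmetric] exp_minus)
        also have "\<dots> \<le> ennreal (exp t / c) * evidence U y"
        proof (rule mult_left_mono)
          show "ennreal (exp (- t)) * ennreal (c * q l y) \<le> evidence U y"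
          proof (cases "evidence (space S) y = \<infinity>")
            case True
            \<comment> \<open>An infinite evidence makes the quotient \<open>0\<close>,
              contradicting the strict inequality \<open>*\<close>.\<close>
            then show ?thesis using * by simp
          next
            case False
            have "ennreal (exp (- t)) * ennreal (c * q l y)
                \<le> evidence U y / evidence (space S) y * evidence (space S) y"
              by (intro mult_mono ** less_imp_le[OF *]) auto
            also have "\<dots> = evidence U y"
              using False evidence_pos[OF y(1)]
              by (subst ennreal_divide_times) (simp add: ennreal_divide_self top.not_eq_extremum)
            finally show ?thesis .
          qed
        qed simp
        finally show ?thesis using y True by (simp only: indicator_simps mult_1_right Diff_iff not_False_eq_True simp_thms)
      qed simp
    qed
    also have "\<dots> = ennreal (exp t / c) * (\<integral>\<^sup>+ y. evidence U y * indicator (space \<mu> - F) y \<partial>\<mu>)"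
      by (rule nn_integral_cmult) measurable
    also have "\<dots> = ?R"
      unfolding evidence_def
      by (subst Fubini_lik) (auto simp: prior.sigma_finite_measure_axioms)
    finally show ?thesis .
  qed
  finally show "emeasure (P l) ?A \<le> emeasure (P l) ?B + emeasure (P l) F + ?R"
    by (simp add: add_left_mono)
qed

lemma evidence_ge_component:
  assumes m: "m \<in> I" and y: "y \<in> space \<mu>" and B: "B \<in> sets S"
  shows "ennreal (w m) * (\<integral>\<^sup>+ \<theta>. ennreal (q (T \<theta>) y) * indicator B \<theta> \<partial>Q m) \<le> evidence (space S) y"
proof -
  note [measurable] = lik_meas_fst[OF y] B
  have "ennreal (w m) * (\<integral>\<^sup>+ \<theta>. ennreal (q (T \<theta>) y) * indicator B \<theta> \<partial>Q m)
      \<le> (\<integral>\<^sup>+ m. ennreal (w m) * (\<integral>\<^sup>+ \<theta>. ennreal (q (T \<theta>) y) * indicator B \<theta> \<partial>Q m) \<partial>count_space I)"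
    using m by (rule nn_integral_ge_point)
  also have "\<dots> = (\<integral>\<^sup>+ \<theta>. ennreal (q (T \<theta>) y) * indicator B \<theta> \<partial>prior)"
    by (rule nn_integral_mixture[symmetric, OF I_countable Q_sets]) measurable
  also have "\<dots> \<le> evidence (space S) y"
    unfolding evidence_def by (intro nn_integral_mono) (auto simp: indicator_def)
  finally show ?thesis .
qed

text \<open>If the evidence is small, then half of the \<open>Q m\<close>-mass of \<open>B\<close> has a small likelihood ratio; Markov's
  inequality for that mass replaces the usual appeal to Jensen's inequality.\<close>

lemma evidence_lower_tail:
  fixes s :: real
  assumes l: "l \<in> \<Lambda>" and m: "m \<in> I" and B: "B \<in> sets S" and pos: "measure (Q m) B > 0"
    and "s > 0" "w m > 0"
    and small: "\<And>\<theta>. \<theta> \<in> B \<Longrightarrow> emeasure (P l) {y \<in> space \<mu>. q (T \<theta>) y \<le> s * q l y} \<le> e"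
  shows "emeasure (P l) {y \<in> space \<mu>. evidence (space S) y < ennreal (w m * (measure (Q m) B / 2) * s * q l y)}
    \<le> 2 * e"
proof -
  interpret Q: prob_space "Q m" by (rule Q_prob[OF m])
  interpret Pl: prob_space "P l" by (rule P_prob[OF l])
  have [measurable_cong]: "sets (Q m) = sets S" by (rule Q_sets[OF m])
  have spQ: "space (Q m) = space S" by (rule sets_eq_imp_space_eq) fact
  note [measurable] = B
  have [measurable]: "q l \<in> borel_measurable \<mu>" by (rule q_meas[OF l])
  define b where "b = measure (Q m) B"
  have b: "emeasure (Q m) B = ennreal b" "b > 0"
    using pos by (auto simp: b_def Q.emeasure_eq_measure)
  let ?N = "{y \<in> space \<mu>. evidence (space S) y < ennreal (w m * (b / 2) * s * q l y)}"
  have N[measurable]: "?N \<in> sets \<mu>" by measurable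
  \<comment> \<open>Indicator of the exceptional pairs: \<open>K y\<close> below is the
    \<open>Q m\<close>-mass of the points of \<open>B\<close> whose likelihood ratio against
    \<open>l\<close> is at most \<open>s\<close>.\<close>
  define k :: "'t \<Rightarrow> 'y \<Rightarrow> ennreal" where "k \<theta> y = indicator {(\<theta>, y). \<theta> \<in> B \<and> q (T \<theta>) y \<le> s * q l y} (\<theta>, y)" for \<theta> y
  have k_le: "k \<theta> y = (if \<theta> \<in> B \<and> q (T \<theta>) y \<le> s * q l y then 1 else 0)" for \<theta> y
    by (simp add: k_def indicator_def)
  have k_meas: "case_prod k \<in> borel_measurable (Q m \<Otimes>\<^sub>M P l)"
  proof -
    have 1: "(\<lambda>x. q (T (fst x)) (snd x)) \<in> borel_measurable (S \<Otimes>\<^sub>M \<mu>)"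
      using lik_meas by (simp add: split_beta')
    have "case_prod k = (\<lambda>x. if fst x \<in> B \<and> q (T (fst x)) (snd x) \<le> s * q l (snd x) then 1 else 0)"
      by (auto simp: k_le fun_eq_iff)
    also have "\<dots> \<in> borel_measurable (S \<Otimes>\<^sub>M \<mu>)"
      using 1 by measurable
    finally have "case_prod k \<in> borel_measurable (S \<Otimes>\<^sub>M \<mu>)" .
    moreover have "sets (Q m \<Otimes>\<^sub>M P l) = sets (S \<Otimes>\<^sub>M \<mu>)"
      using Q_sets[OF m] by (intro sets_pair_measure_cong) auto
    ultimately show ?thesis by (simp cong: measurable_cong_sets)
  qed
  define K where "K y = (\<integral>\<^sup>+ \<theta>. k \<theta> y \<partial>Q m)" for y
  interpret QP: pair_sigma_finite "Q m" "P l" ..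
  \<comment> \<open>If at most half of \<open>B\<close> were exceptional, the other half would have
    likelihood above \<open>s * q l y\<close>, and the contribution of model \<open>m\<close> alone
    would lift the evidence to the threshold in \<open>?N\<close>. Hence
    \<open>K y > b / 2\<close>.\<close>
  have K_big: "1 \<le> ennreal (2 / b) * K y" if y: "y \<in> ?N" for y
  proof -
    have ysp: "y \<in> space \<mu>" using y by simp
    have q: "q l y > 0" using q_pos[OF l ysp] .
    note [measurable] = lik_meas_fst[OF ysp]
    have km: "(\<lambda>\<theta>. k \<theta> y) \<in> borel_measurable (Q m)"
      using measurable_Pair1[OF k_meas, of y] ysp by simp
    let ?J = "\<integral>\<^sup>+ \<theta>. ennreal (q (T \<theta>) y) * indicator B \<theta> \<partial>Q m"
    have "ennreal (s * q l y) * emeasure (Q m) B = (\<integral>\<^sup>+ \<theta>. ennreal (s * q l y) * indicator B \<theta> \<partial>Q m)"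
      by (simp add: nn_integral_cmult_indicator)
    also have "\<dots> \<le> (\<integral>\<^sup>+ \<theta>. ennreal (s * q l y) * k \<theta> y + ennreal (q (T \<theta>) y) * indicator B \<theta> \<partial>Q m)"
      by (intro nn_integral_mono) (auto simp: k_le indicator_def intro!: ennreal_leI)
    also have "\<dots> = ennreal (s * q l y) * K y + ?J"
      unfolding K_def using km by (subst nn_integral_add) (auto simp: nn_integral_cmult)
    finally have main: "ennreal (s * q l y) * ennreal b \<le> ennreal (s * q l y) * K y + ?J"
      using b by simp
    have "ennreal (w m) * ?J < ennreal (w m * (b / 2) * s * q l y)"
      using evidence_ge_component[OF m ysp B] y by (auto intro: le_less_trans)
    also have "\<dots> = ennreal (w m) * ennreal (b / 2 * s * q l y)"
      using \<open>w m > 0\<close> b \<open>s > 0\<close> q by (simp add: ennreal_mult[symmetric] mult.assoc)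
    finally have J: "?J < ennreal (b / 2 * s * q l y)"
      by (metis mult_left_mono not_le zero_le)
    have "K y \<le> 1"
    proof -
      have "K y \<le> (\<integral>\<^sup>+ \<theta>. 1 \<partial>Q m)" unfolding K_def
        by (intro nn_integral_mono) (simp add: k_le)
      then show ?thesis by (simp add: Q.emeasure_space_1)
    qed
    then obtain K' where K': "K y = ennreal K'" "K' \<ge> 0" by (cases "K y") (auto simp: top_unique)
    obtain J' where J': "?J = ennreal J'" "J' \<ge> 0" using J by (cases ?J) auto
    have "J' < b / 2 * s * q l y" using J J' by (simp add: ennreal_less_iff)
    moreover have "s * q l y * b \<le> s * q l y * K' + J'"
      using main K' J' b q \<open>s > 0\<close> by (simp add: ennreal_mult[symmetric] ennreal_plus[symmetric] del: ennreal_plus)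
    ultimately have "(s * q l y) * (b / 2) < (s * q l y) * K'" by (simp add: algebra_simps)
    then have "b / 2 < K'" using q \<open>s > 0\<close> by (simp add: mult_less_cancel_left_pos)
    then have "1 \<le> 2 / b * K'" using b by (simp add: field_simps)
    then have "ennreal 1 \<le> ennreal (2 / b * K')" by (rule ennreal_leI)
    then show ?thesis using b K' by (subst K', subst ennreal_mult[symmetric]) auto
  qed
  have "(\<integral>\<^sup>+ y. K y \<partial>P l) = (\<integral>\<^sup>+ \<theta>. (\<integral>\<^sup>+ y. k \<theta> y \<partial>P l) \<partial>Q m)"
    unfolding K_def by (rule QP.Fubini'[OF k_meas])
  also have "\<dots> \<le> (\<integral>\<^sup>+ \<theta>. e * indicator B \<theta> \<partial>Q m)"
  proof (rule nn_integral_mono)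
    fix \<theta> assume \<theta>: "\<theta> \<in> space (Q m)"
    have [measurable]: "q (T \<theta>) \<in> borel_measurable \<mu>" using \<theta> spQ by (intro lik_meas_snd) simp
    show "(\<integral>\<^sup>+ y. k \<theta> y \<partial>P l) \<le> e * indicator B \<theta>"
    proof (cases "\<theta> \<in> B")
      case True
      have "(\<integral>\<^sup>+ y. k \<theta> y \<partial>P l) = (\<integral>\<^sup>+ y. indicator {y \<in> space \<mu>. q (T \<theta>) y \<le> s * q l y} y \<partial>P l)"
        using True by (intro nn_integral_cong) (auto simp: k_le)
      also have "\<dots> \<le> e" using small[OF True] by simp
      finally show ?thesis using True by simp
    qed (simp add: k_le)
  qed
  also have "\<dots> = e * ennreal b"
    using b by (simp add: nn_integral_cmult_indicator)
  finally have K_int: "(\<integral>\<^sup>+ y. K y \<partial>P l) \<le> e * ennreal b" .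
  \<comment> \<open>Markov's inequality at the level \<open>b / 2\<close>; the mass \<open>b\<close>
    cancels against the bound \<open>e * ennreal b\<close> for the mean of \<open>K\<close>.\<close>
  have "emeasure (P l) ?N = (\<integral>\<^sup>+ y. indicator ?N y \<partial>P l)" by simp
  also have "\<dots> \<le> (\<integral>\<^sup>+ y. ennreal (2 / b) * K y \<partial>P l)"
    using K_big by (intro nn_integral_mono) (auto simp: indicator_def)
  also have "\<dots> = ennreal (2 / b) * (\<integral>\<^sup>+ y. K y \<partial>P l)"
  proof (rule nn_integral_cmult)
    have "(\<lambda>(y, \<theta>). k \<theta> y) \<in> borel_measurable (P l \<Otimes>\<^sub>M Q m)"
      using measurable_pair_swap[OF k_meas] by (simp add: split_beta')
    then show "K \<in> borel_measurable (P l)"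
      unfolding K_def by (rule Q.borel_measurable_nn_integral)
  qed
  also have "\<dots> \<le> ennreal (2 / b) * (e * ennreal b)"
    using K_int by (rule mult_left_mono) simp
  also have "\<dots> = (ennreal (2 / b) * ennreal b) * e" by (simp add: ac_simps)
  also have "ennreal (2 / b) * ennreal b = ennreal 2"
    using b by (subst ennreal_mult[symmetric]) auto
  finally show ?thesis by (simp add: b_def)
qed

end

section \<open>Coverings and tests over shells\<close>

lemma covering_number_attained:
  assumes "covering_number u S dd \<noteq> \<infinity>"
  obtains F where "finite F" "F \<subseteq> S" "\<And>x. x \<in> S \<Longrightarrow> \<exists>c\<in>F. dd c x \<le> u"
    "card F = the_enat (covering_number u S dd)"
proof -
  let ?X = "{enat (card F) | F. finite F \<and> F \<subseteq> S \<and> (\<forall>x\<in>S. \<exists>c\<in>F. dd c x \<le> u)}"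
  \<comment> \<open>The infimum of the empty set is \<open>\<infinity>\<close>, which is excluded; a
    nonempty set of extended naturals attains its infimum.\<close>
  have "?X \<noteq> {}"
  proof
    assume "?X = {}"
    then have "covering_number u S dd = \<infinity>"
      unfolding covering_number_def by (simp only: Inf_enat_def simp_thms if_True)
    with assms show False by simp
  qed
  then have "Inf ?X \<in> ?X"
    unfolding Inf_enat_def by (auto intro: LeastI)
  then have "covering_number u S dd \<in> ?X" unfolding covering_number_def .
  then obtain F where "covering_number u S dd = enat (card F)"
    "finite F" "F \<subseteq> S" "\<forall>x\<in>S. \<exists>c\<in>F. dd c x \<le> u" by blast
  then show thesis by (intro that[of F]) auto
qed

context mixture_model begin

text \<open>The shells \<open>{z \<le> d \<le> 2 z}\<close>, \<open>z = R, 2 R, 3 R, \<dots>\<close>, exhaust \<open>{d \<ge> R}\<close>; the test is the union of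
  the likelihood ratio tests of \<open>l\<close> against the centres of coverings of all shells.\<close>

lemma exists_test:
  fixes R u :: real and N :: "'m \<Rightarrow> real" and g :: "real \<Rightarrow> ennreal" and d :: "'l \<Rightarrow> 'l \<Rightarrow> real"
  assumes l: "l \<in> \<Lambda>" and J: "J \<subseteq> I" and R: "R > 0" and u: "u \<le> 1 / 2"
    and triangle: "\<And>a b c. a \<in> \<Lambda> \<Longrightarrow> b \<in> \<Lambda> \<Longrightarrow> c \<in> \<Lambda> \<Longrightarrow> d a c \<le> d a b + d b c"
    and sym: "\<And>a b. a \<in> \<Lambda> \<Longrightarrow> b \<in> \<Lambda> \<Longrightarrow> d a b = d b a"
    and cover: "\<And>m z. m \<in> J \<Longrightarrow> z \<ge> R \<Longrightarrow> \<exists>F. finite F \<and> F \<subseteq> \<Theta> m \<and> real (card F) \<le> N m \<and>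
        (\<forall>\<theta>\<in>\<Theta> m. d (T \<theta>) l \<le> 2 * z \<longrightarrow> (\<exists>c\<in>F. d (T c) (T \<theta>) \<le> u * z))"
    and first_kind: "\<And>c z. c \<in> \<Lambda> \<Longrightarrow> z \<ge> R \<Longrightarrow> z / 2 \<le> d l c \<Longrightarrow>
        emeasure (P l) {y \<in> space \<mu>. q l y \<le> q c y} \<le> g z"
    and second_kind: "\<And>a c z. a \<in> \<Lambda> \<Longrightarrow> c \<in> \<Lambda> \<Longrightarrow> z \<ge> R \<Longrightarrow> z / 2 \<le> d l c \<Longrightarrow> d a c \<le> u * z \<Longrightarrow>
        emeasure (P a) {y \<in> space \<mu>. q c y \<le> q l y} \<le> g z"
    and g_mono: "\<And>z. z \<ge> R \<Longrightarrow> g z \<le> g R"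
  obtains F where "F \<in> sets \<mu>"
    "emeasure (P l) F \<le> (\<integral>\<^sup>+ m. ennreal (N m) \<partial>count_space J) * (\<Sum>j. g (real (Suc j) * R))"
    "\<And>m \<theta>. m \<in> J \<Longrightarrow> \<theta> \<in> \<Theta> m \<Longrightarrow> R \<le> d (T \<theta>) l \<Longrightarrow> emeasure (P (T \<theta>)) (space \<mu> - F) \<le> g R"
proof -
  define z where "z j = real (Suc j) * R" for j
  have z_ge: "R \<le> z j" for j
    using R by (simp add: z_def algebra_simps)
  have "\<forall>m j. m \<in> J \<longrightarrow> (\<exists>F. finite F \<and> F \<subseteq> \<Theta> m \<and> real (card F) \<le> N m \<and>
        (\<forall>\<theta>\<in>\<Theta> m. d (T \<theta>) l \<le> 2 * z j \<longrightarrow> (\<exists>c\<in>F. d (T c) (T \<theta>) \<le> u * z j)))"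
    using cover z_ge by blast
  then obtain C where C: "\<And>m j. m \<in> J \<Longrightarrow> finite (C m j) \<and> C m j \<subseteq> \<Theta> m \<and> real (card (C m j)) \<le> N m \<and>
        (\<forall>\<theta>\<in>\<Theta> m. d (T \<theta>) l \<le> 2 * z j \<longrightarrow> (\<exists>c\<in>C m j. d (T c) (T \<theta>) \<le> u * z j))"
    by metis
  \<comment> \<open>A centre closer to \<open>l\<close> than \<open>z j / 2\<close> covers no point
    with \<open>z j \<le> d (T \<theta>) l\<close>, because \<open>u \<le> 1 / 2\<close>; its test
    would have no error bound, so it is discarded.\<close>
  define G where "G m j = {c \<in> C m j. z j / 2 \<le> d l (T c)}" for m j
  have G: "finite (G m j)" "\<And>c. c \<in> G m j \<Longrightarrow> T c \<in> \<Lambda> \<and> z j / 2 \<le> d l (T c)"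
      "real (card (G m j)) \<le> N m" if "m \<in> J" for m j
  proof -
    show "finite (G m j)" using C[OF that, of j] by (simp add: G_def)
    show "T c \<in> \<Lambda> \<and> z j / 2 \<le> d l (T c)" if "c \<in> G m j" for c
      using C[OF \<open>m \<in> J\<close>, of j] that J \<open>m \<in> J\<close> T_range by (auto simp: G_def)
    have "card (G m j) \<le> card (C m j)" using C[OF that, of j] by (intro card_mono) (auto simp: G_def)
    then show "real (card (G m j)) \<le> N m" using C[OF that, of j] by linarith
  qed
  define E where "E c = {y \<in> space \<mu>. q l y \<le> q (T c) y}" for c
  have E_sets: "E c \<in> sets \<mu>" if "T c \<in> \<Lambda>" for c
  proof -
    note [measurable] = q_meas[OF that] q_meas[OF l]
    show ?thesis unfolding E_def by measurable
  qed
  define F where "F = (\<Union>m\<in>J. \<Union>j. \<Union>c\<in>G m j. E c)"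
  have J_countable: "countable J" using J I_countable by (rule countable_subset)
  have Gj_sets: "(\<Union>c\<in>G m j. E c) \<in> sets \<mu>" if "m \<in> J" for m j
    using G[OF that] by (intro sets.finite_UN E_sets) auto
  have Fm_sets: "(\<Union>j. \<Union>c\<in>G m j. E c) \<in> sets \<mu>" if "m \<in> J" for m
    using Gj_sets[OF that] by (intro sets.countable_UN) auto
  show thesis
  proof (rule that[of F])
    show F_sets: "F \<in> sets \<mu>"
      unfolding F_def using J_countable Fm_sets by (rule sets.countable_UN'')
    have "emeasure (P l) F \<le> (\<integral>\<^sup>+ m. emeasure (P l) (\<Union>j. \<Union>c\<in>G m j. E c) \<partial>count_space J)"
      unfolding F_def using J_countable Fm_sets by (intro emeasure_UN_le_nn_integral) auto
    also have "\<dots> \<le> (\<integral>\<^sup>+ m. ennreal (N m) * (\<Sum>j. g (z j)) \<partial>count_space J)"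
    proof (rule nn_integral_mono)
      fix m assume "m \<in> space (count_space J)"
      then have m: "m \<in> J" by simp
      have "emeasure (P l) (\<Union>j. \<Union>c\<in>G m j. E c) \<le> (\<Sum>j. emeasure (P l) (\<Union>c\<in>G m j. E c))"
        using Gj_sets[OF m] by (intro emeasure_subadditive_countably) auto
      also have "\<dots> \<le> (\<Sum>j. ennreal (N m) * g (z j))"
      proof (intro suminf_le)
        fix j
        have "emeasure (P l) (\<Union>c\<in>G m j. E c) \<le> (\<Sum>c\<in>G m j. emeasure (P l) (E c))"
          using G[OF m] E_sets by (intro emeasure_subadditive_finite) auto
        also have "\<dots> \<le> (\<Sum>c\<in>G m j. g (z j))"
          unfolding E_def using G(2)[OF m] z_ge by (intro sum_mono first_kind) auto
        also have "\<dots> = ennreal (real (card (G m j))) * g (z j)"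
          by (simp add: ennreal_of_nat_eq_real_of_nat)
        also have "\<dots> \<le> ennreal (N m) * g (z j)"
          using G(3)[OF m] by (intro mult_right_mono ennreal_leI) auto
        finally show "emeasure (P l) (\<Union>c\<in>G m j. E c) \<le> ennreal (N m) * g (z j)" .
      qed auto
      also have "\<dots> = ennreal (N m) * (\<Sum>j. g (z j))" by simp
      finally show "emeasure (P l) (\<Union>j. \<Union>c\<in>G m j. E c) \<le> ennreal (N m) * (\<Sum>j. g (z j))" .
    qed
    also have "\<dots> = (\<integral>\<^sup>+ m. ennreal (N m) \<partial>count_space J) * (\<Sum>j. g (z j))"
      by (rule nn_integral_multc) simp
    finally show "emeasure (P l) F \<le> (\<integral>\<^sup>+ m. ennreal (N m) \<partial>count_space J) * (\<Sum>j. g (real (Suc j) * R))"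
      by (simp only: z_def)
  next
    fix m \<theta> assume m: "m \<in> J" and \<theta>: "\<theta> \<in> \<Theta> m" and far: "R \<le> d (T \<theta>) l"
    have T\<theta>: "T \<theta> \<in> \<Lambda>" using T_range m J \<theta> by auto
    \<comment> \<open>The floor is at least one, so the truncated subtraction is exact. This
      \<open>j\<close> satisfies \<open>z j \<le> d (T \<theta>) l < z j + R\<close>, and
      \<open>R \<le> z j\<close> places \<theta> in the shell of index \<open>j\<close>.\<close>
    define j where "j = nat \<lfloor>d (T \<theta>) l / R\<rfloor> - 1"
    have "1 \<le> d (T \<theta>) l / R" using far R by simp
    then have "1 \<le> \<lfloor>d (T \<theta>) l / R\<rfloor>" by simp
    then have Sj: "real (Suc j) = of_int \<lfloor>d (T \<theta>) l / R\<rfloor>"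
      by (simp add: j_def of_nat_diff)
    have "real (Suc j) \<le> d (T \<theta>) l / R" "d (T \<theta>) l / R < real (Suc j) + 1"
      unfolding Sj by linarith+
    then have lo: "z j \<le> d (T \<theta>) l" and "d (T \<theta>) l < z j + R"
      using R by (auto simp: z_def field_simps)
    then have hi: "d (T \<theta>) l \<le> 2 * z j" using z_ge[of j] by simp
    obtain c where c: "c \<in> C m j" "d (T c) (T \<theta>) \<le> u * z j"
      using C[OF m, of j] \<theta> hi by blast
    have Tc: "T c \<in> \<Lambda>" using C[OF m, of j] c(1) T_range m J by auto
    have "u * z j \<le> 1 / 2 * z j" using u z_ge[of j] R by (intro mult_right_mono) auto
    moreover have "d (T \<theta>) l \<le> d (T c) (T \<theta>) + d l (T c)"
      using triangle[OF T\<theta> Tc l] sym[OF T\<theta> Tc] sym[OF Tc l] by simp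
    ultimately have cz: "z j / 2 \<le> d l (T c)" using lo c(2) by simp
    have E_sub: "E c \<subseteq> F"
      unfolding F_def using m c(1) cz by (auto simp: G_def)
    note [measurable] = q_meas[OF Tc] q_meas[OF l] q_meas[OF T\<theta>]
    have "emeasure (P (T \<theta>)) (space \<mu> - F) \<le> emeasure (P (T \<theta>)) {y \<in> space \<mu>. q (T c) y \<le> q l y}"
      using E_sub by (intro emeasure_mono) (auto simp: E_def)
    also have "\<dots> \<le> g (z j)"
      using c(2) sym[OF T\<theta> Tc] z_ge by (intro second_kind[OF T\<theta> Tc _ cz]) auto
    also have "\<dots> \<le> g R" using z_ge by (rule g_mono)
    finally show "emeasure (P (T \<theta>)) (space \<mu> - F) \<le> g R" .
  qed
qed

lemma emeasure_lik_meas: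
  assumes "F \<in> sets \<mu>"
  shows "(\<lambda>\<theta>. emeasure (P (T \<theta>)) F) \<in> borel_measurable S"
proof -
  note [measurable] = assms
  have "(\<lambda>\<theta>. \<integral>\<^sup>+ y. ennreal (q (T \<theta>) y) * indicator F y \<partial>\<mu>) \<in> borel_measurable S"
    by (rule borel_measurable_nn_integral) (simp add: split_beta', measurable)
  moreover have "emeasure (P (T \<theta>)) F = (\<integral>\<^sup>+ y. ennreal (q (T \<theta>) y) * indicator F y \<partial>\<mu>)"
    if "\<theta> \<in> space S" for \<theta>
    using lik_meas_snd[OF that] by (simp add: emeasure_density)
  ultimately show ?thesis by (simp cong: measurable_cong)
qed

text \<open>The test detects only the models in \<open>J\<close>, where coverings are available;
  models outside \<open>J\<close> are charged their full prior weight. Both contributions are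
  multiplied by \<open>exp t\<close> and divided by the evidence bound, which stems from the single
  model \<open>m\<close> and its subset \<open>B\<close>.\<close>

lemma posterior_tail_bound:
  fixes R u s t :: real and N :: "'m \<Rightarrow> real" and g :: "real \<Rightarrow> ennreal" and d :: "'l \<Rightarrow> 'l \<Rightarrow> real"
  assumes l: "l \<in> \<Lambda>" and J: "J \<subseteq> I" and R: "R > 0" and u: "u \<le> 1 / 2"
    and triangle: "\<And>a b c. a \<in> \<Lambda> \<Longrightarrow> b \<in> \<Lambda> \<Longrightarrow> c \<in> \<Lambda> \<Longrightarrow> d a c \<le> d a b + d b c"
    and sym: "\<And>a b. a \<in> \<Lambda> \<Longrightarrow> b \<in> \<Lambda> \<Longrightarrow> d a b = d b a"
    and U: "{\<theta> \<in> space S. R \<le> d (T \<theta>) l} \<in> sets S"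
    and cover: "\<And>m z. m \<in> J \<Longrightarrow> z \<ge> R \<Longrightarrow> \<exists>F. finite F \<and> F \<subseteq> \<Theta> m \<and> real (card F) \<le> N m \<and>
        (\<forall>\<theta>\<in>\<Theta> m. d (T \<theta>) l \<le> 2 * z \<longrightarrow> (\<exists>c\<in>F. d (T c) (T \<theta>) \<le> u * z))"
    and first_kind: "\<And>c z. c \<in> \<Lambda> \<Longrightarrow> z \<ge> R \<Longrightarrow> z / 2 \<le> d l c \<Longrightarrow>
        emeasure (P l) {y \<in> space \<mu>. q l y \<le> q c y} \<le> g z"
    and second_kind: "\<And>a c z. a \<in> \<Lambda> \<Longrightarrow> c \<in> \<Lambda> \<Longrightarrow> z \<ge> R \<Longrightarrow> z / 2 \<le> d l c \<Longrightarrow> d a c \<le> u * z \<Longrightarrow>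
        emeasure (P a) {y \<in> space \<mu>. q c y \<le> q l y} \<le> g z"
    and g_mono: "\<And>z. z \<ge> R \<Longrightarrow> g z \<le> g R"
    and m: "m \<in> I" and B: "B \<in> sets S" and pos: "measure (Q m) B > 0"
    and "s > 0" "w m > 0"
    and small: "\<And>\<theta>. \<theta> \<in> B \<Longrightarrow> emeasure (P l) {y \<in> space \<mu>. q (T \<theta>) y \<le> s * q l y} \<le> e"
  shows "emeasure (P l) {y \<in> space \<mu>. ennreal (exp (- t)) < emeasure (post y) {\<theta> \<in> space S. R \<le> d (T \<theta>) l}}
    \<le> 2 * e + (\<integral>\<^sup>+ m. ennreal (N m) \<partial>count_space J) * (\<Sum>j. g (real (Suc j) * R))
      + ennreal (exp t / (w m * (measure (Q m) B / 2) * s))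
        * (g R + (\<integral>\<^sup>+ m. ennreal (w m) \<partial>count_space (I - J)))"
proof -
  let ?U = "{\<theta> \<in> space S. R \<le> d (T \<theta>) l}"
  let ?c = "w m * (measure (Q m) B / 2) * s"
  have c: "?c > 0" using pos \<open>s > 0\<close> \<open>w m > 0\<close> by simp
  obtain F where F: "F \<in> sets \<mu>"
    and F1: "emeasure (P l) F \<le> (\<integral>\<^sup>+ m. ennreal (N m) \<partial>count_space J) * (\<Sum>j. g (real (Suc j) * R))"
    and F2: "\<And>m \<theta>. m \<in> J \<Longrightarrow> \<theta> \<in> \<Theta> m \<Longrightarrow> R \<le> d (T \<theta>) l \<Longrightarrow> emeasure (P (T \<theta>)) (space \<mu> - F) \<le> g R"
    by (rule exists_test[of l J R u d N g, OF l J R u triangle sym cover first_kind second_kind g_mono]) blast+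
  have Fc: "space \<mu> - F \<in> sets \<mu>" using F by auto
  have "(\<integral>\<^sup>+ \<theta>. emeasure (P (T \<theta>)) (space \<mu> - F) * indicator ?U \<theta> \<partial>prior)
      = (\<integral>\<^sup>+ m. ennreal (w m) * (\<integral>\<^sup>+ \<theta>. emeasure (P (T \<theta>)) (space \<mu> - F) * indicator ?U \<theta> \<partial>Q m) \<partial>count_space I)"
    using U emeasure_lik_meas[OF Fc]
    by (intro nn_integral_mixture[OF I_countable Q_sets]) auto
  \<comment> \<open>A parameter of \<open>?U\<close> goes undetected with probability at most
    \<open>g R\<close> if its model lies in \<open>J\<close>, and trivially at most one
    otherwise.\<close>
  also have "\<dots> \<le> (\<integral>\<^sup>+ m. g R * ennreal (w m) + ennreal (w m) * indicator (I - J) m \<partial>count_space I)"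
  proof (rule nn_integral_mono)
    fix k assume "k \<in> space (count_space I)"
    then have k: "k \<in> I" by simp
    interpret Qk: prob_space "Q k" by (rule Q_prob[OF k])
    have "(\<integral>\<^sup>+ \<theta>. emeasure (P (T \<theta>)) (space \<mu> - F) * indicator ?U \<theta> \<partial>Q k)
        \<le> (\<integral>\<^sup>+ \<theta>. (if k \<in> J then g R else 1) \<partial>Q k)"
    proof (rule nn_integral_mono_AE)
      show "AE \<theta> in Q k. emeasure (P (T \<theta>)) (space \<mu> - F) * indicator ?U \<theta> \<le> (if k \<in> J then g R else 1)"
        using Q_AE[OF k]
      proof eventually_elim
        case (elim \<theta>)
        have "emeasure (P (T \<theta>)) (space \<mu> - F) \<le> 1"
          using T_range[OF k elim] by (intro prob_space.measure_le_1 P_prob)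
        then show ?case using F2[OF _ elim] by (auto simp: indicator_def)
      qed
    qed
    also have "\<dots> = (if k \<in> J then g R else 1)" by (simp add: Qk.emeasure_space_1)
    finally have "ennreal (w k) * (\<integral>\<^sup>+ \<theta>. emeasure (P (T \<theta>)) (space \<mu> - F) * indicator ?U \<theta> \<partial>Q k)
        \<le> ennreal (w k) * (if k \<in> J then g R else 1)" by (rule mult_left_mono) simp
    also have "\<dots> \<le> g R * ennreal (w k) + ennreal (w k) * indicator (I - J) k"
      using k by (auto simp: mult.commute)
    finally show "ennreal (w k) * (\<integral>\<^sup>+ \<theta>. emeasure (P (T \<theta>)) (space \<mu> - F) * indicator ?U \<theta> \<partial>Q k)
        \<le> g R * ennreal (w k) + ennreal (w k) * indicator (I - J) k" .
  qed
  also have "\<dots> = g R + (\<integral>\<^sup>+ m. ennreal (w m) \<partial>count_space (I - J))"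
    by (subst nn_integral_add)
      (auto simp: nn_integral_cmult w_sum nn_integral_count_space_indicator indicator_def intro!: nn_integral_cong)
  finally have missed: "(\<integral>\<^sup>+ \<theta>. emeasure (P (T \<theta>)) (space \<mu> - F) * indicator ?U \<theta> \<partial>prior)
      \<le> g R + (\<integral>\<^sup>+ m. ennreal (w m) \<partial>count_space (I - J))" .
  show ?thesis
    by (rule order_trans[OF posterior_tail(1)[OF l U F c]])
      (intro add_mono mult_left_mono missed F1
        evidence_lower_tail[OF l m B pos \<open>s > 0\<close> \<open>w m > 0\<close> small], auto)
qed

text \<open>Since the centre is at distance at least \<open>z / 2\<close>, both errors at the centre
  are a constant times \<open>exp (- 2 * v * \<nu> * z\<^sup>2)\<close>. Passing to a parameter
  within \<open>u * z\<close> truncates the density ratio at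
  \<open>exp (v * \<nu> * z\<^sup>2)\<close>: this spends half of the exponent, and the part above
  the truncation contributes the rate \<open>(\<rho>p - 1) * v\<close>, half of which survives the
  divergence allowed by \<open>u\<close>. \<open>\<kappa>\<close> is the smaller of the two rates,
  and \<open>C\<close> collects the additive constants of (A).\<close>

lemma likelihood_ratio_test_bounds:
  fixes a1 a2 c1 c2 :: real and \<nu> :: real
  assumes l: "l \<in> \<Lambda>" and \<rho>0: "0 < \<rho>0" "\<rho>0 < 1" and \<rho>p: "\<rho>p > 1" and "c1 > 0" "c2 > 0" "\<nu> \<ge> 0"
    and lower: "\<And>a b. a \<in> \<Lambda> \<Longrightarrow> b \<in> \<Lambda> \<Longrightarrow> ereal (a1 + c1 * \<nu> * (d a b)\<^sup>2) \<le> renyi_div \<rho>0 (P a) (P b)"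
    and upper: "\<And>a b. a \<in> \<Lambda> \<Longrightarrow> b \<in> \<Lambda> \<Longrightarrow> renyi_div \<rho>p (P a) (P b) \<le> ereal (a2 + c2 * \<nu> * (d a b)\<^sup>2)"
    and nonneg: "\<And>a b. a \<in> \<Lambda> \<Longrightarrow> b \<in> \<Lambda> \<Longrightarrow> d a b \<ge> 0"
    and v: "v = (1 - \<rho>0) * c1 / 8" and u: "c2 * u\<^sup>2 \<le> v / 2"
    and \<kappa>: "\<kappa> = min ((\<rho>p - 1) * (v / 2)) v"
    and C: "C = exp ((\<rho>p - 1) * a2) + exp (- (1 - \<rho>0) * a1)"
    and c: "c \<in> \<Lambda>" and z: "z \<ge> 0" and far: "z / 2 \<le> d l c"
  shows "emeasure (P l) {y \<in> space \<mu>. q l y \<le> q c y} \<le> ennreal (C * exp (- \<kappa> * \<nu> * z\<^sup>2))"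
    and "a \<in> \<Lambda> \<Longrightarrow> d a c \<le> u * z \<Longrightarrow>
      emeasure (P a) {y \<in> space \<mu>. q c y \<le> q l y} \<le> ennreal (C * exp (- \<kappa> * \<nu> * z\<^sup>2))"
proof -
  interpret lc: positive_density_pair \<mu> "q l" "q c" by (rule positive_density_pairI[OF l c])
  define h where "h = exp (- (1 - \<rho>0) * a1) * exp (- 2 * v * (\<nu> * z\<^sup>2))"
  have v_pos: "v > 0" unfolding v using \<rho>0 \<open>c1 > 0\<close> by simp
  have \<kappa>_le: "\<kappa> \<le> v" "\<kappa> \<le> (\<rho>p - 1) * (v / 2)" by (auto simp: \<kappa>)
  have nz: "\<nu> * z\<^sup>2 \<ge> 0" using \<open>\<nu> \<ge> 0\<close> by simp
  have "lc.power_integral (- (1 - \<rho>0)) \<le> ennreal (exp ((\<rho>0 - 1) * (a1 + c1 * \<nu> * (d l c)\<^sup>2)))"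
    using lc.power_integral_le[of \<rho>0 "a1 + c1 * \<nu> * (d l c)\<^sup>2"] lower[OF l c] \<rho>0 by simp
  also have "\<dots> \<le> ennreal h"
  proof (rule ennreal_leI)
    have "(z / 2)\<^sup>2 \<le> (d l c)\<^sup>2" using far z by (intro power_mono) auto
    then have "(1 - \<rho>0) * c1 * \<nu> * (z / 2)\<^sup>2 \<le> (1 - \<rho>0) * c1 * \<nu> * (d l c)\<^sup>2"
      using \<rho>0 \<open>c1 > 0\<close> \<open>\<nu> \<ge> 0\<close> by (intro mult_left_mono) auto
    moreover have "(1 - \<rho>0) * c1 * \<nu> * (z / 2)\<^sup>2 = 2 * v * (\<nu> * z\<^sup>2)"
      unfolding v by (simp add: power2_eq_square)
    ultimately have "(\<rho>0 - 1) * (a1 + c1 * \<nu> * (d l c)\<^sup>2) \<le> - (1 - \<rho>0) * a1 + - 2 * v * (\<nu> * z\<^sup>2)"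
      by (simp add: algebra_simps)
    then show "exp ((\<rho>0 - 1) * (a1 + c1 * \<nu> * (d l c)\<^sup>2)) \<le> h"
      unfolding h_def by (simp flip: exp_add)
  qed
  finally have I: "lc.power_integral (- (1 - \<rho>0)) \<le> ennreal h" .
  have h_le: "h \<le> C * exp (- \<kappa> * \<nu> * z\<^sup>2)"
  proof -
    have "\<kappa> * (\<nu> * z\<^sup>2) \<le> 2 * v * (\<nu> * z\<^sup>2)"
      using \<kappa>_le(1) v_pos nz by (intro mult_right_mono) auto
    then have "exp (- 2 * v * (\<nu> * z\<^sup>2)) \<le> exp (- \<kappa> * \<nu> * z\<^sup>2)" by (simp add: mult.assoc)
    then show ?thesis unfolding h_def C by (intro mult_mono) auto
  qed
  have "emeasure (P l) {y \<in> space \<mu>. q l y \<le> q c y} \<le> lc.power_integral (- (1 - \<rho>0))"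
    using \<rho>0 by (intro lc.likelihood_ratio_error_first) auto
  also note I
  also have "ennreal h \<le> ennreal (C * exp (- \<kappa> * \<nu> * z\<^sup>2))" using h_le by (rule ennreal_leI)
  finally show "emeasure (P l) {y \<in> space \<mu>. q l y \<le> q c y} \<le> ennreal (C * exp (- \<kappa> * \<nu> * z\<^sup>2))" .
  show "emeasure (P a) {y \<in> space \<mu>. q c y \<le> q l y} \<le> ennreal (C * exp (- \<kappa> * \<nu> * z\<^sup>2))"
    if a: "a \<in> \<Lambda>" and close: "d a c \<le> u * z"
  proof -
    interpret ac: positive_density_pair \<mu> "q a" "q c" by (rule positive_density_pairI[OF a c])
    define r where "r = \<rho>p - 1"
    have r: "r > 0" using \<rho>p by (simp add: r_def)
    have "(d a c)\<^sup>2 \<le> (u * z)\<^sup>2" using close nonneg[OF a c] by (intro power_mono) auto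
    then have "c2 * (d a c)\<^sup>2 \<le> c2 * (u * z)\<^sup>2" using \<open>c2 > 0\<close> by simp
    also have "\<dots> \<le> v / 2 * z\<^sup>2"
      using mult_right_mono[OF u, of "z\<^sup>2"] by (simp add: power_mult_distrib mult.assoc)
    finally have *: "c2 * (d a c)\<^sup>2 * \<nu> \<le> v / 2 * z\<^sup>2 * \<nu>" using \<open>\<nu> \<ge> 0\<close> by (rule mult_right_mono)
    have J: "ac.power_integral r \<le> ennreal (exp (r * (a2 + c2 * \<nu> * (d a c)\<^sup>2)))"
      using ac.power_integral_le[of \<rho>p "a2 + c2 * \<nu> * (d a c)\<^sup>2"] upper[OF a c] \<rho>p by (simp add: r_def)
    have E_sets: "{y \<in> space \<mu>. q c y \<le> q l y} \<in> sets \<mu>"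
    proof -
      note [measurable] = q_meas[OF l] q_meas[OF c]
      show ?thesis by measurable
    qed
    have "emeasure (P a) {y \<in> space \<mu>. q c y \<le> q l y}
        \<le> ennreal (exp (- r * (v * (\<nu> * z\<^sup>2)))) * ac.power_integral r
          + ennreal (exp (v * (\<nu> * z\<^sup>2))) * emeasure (P c) {y \<in> space \<mu>. q c y \<le> q l y}"
      by (rule ac.emeasure_le_change_of_density[OF r E_sets])
    also have "\<dots> \<le> ennreal (exp (- r * (v * (\<nu> * z\<^sup>2)))) * ennreal (exp (r * (a2 + c2 * \<nu> * (d a c)\<^sup>2)))
          + ennreal (exp (v * (\<nu> * z\<^sup>2))) * ennreal h"
      using \<rho>0 by (intro add_mono mult_left_mono J order_trans[OF lc.likelihood_ratio_error_second I]) auto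
    also have "\<dots> = ennreal (exp (- r * (v * (\<nu> * z\<^sup>2))) * exp (r * (a2 + c2 * \<nu> * (d a c)\<^sup>2))
          + exp (v * (\<nu> * z\<^sup>2)) * h)"
      by (simp add: h_def ennreal_mult)
    also have "\<dots> \<le> ennreal (C * exp (- \<kappa> * \<nu> * z\<^sup>2))"
    proof (rule ennreal_leI)
      have "r * (c2 * \<nu> * (d a c)\<^sup>2) \<le> r * (v / 2 * z\<^sup>2 * \<nu>)"
        using * r by (intro mult_left_mono) (auto simp: mult_ac)
      moreover have "\<kappa> * (\<nu> * z\<^sup>2) \<le> r * (v / 2) * (\<nu> * z\<^sup>2)"
        using \<kappa>_le(2) nz by (intro mult_right_mono) (auto simp: r_def)
      ultimately have "- r * (v * (\<nu> * z\<^sup>2)) + r * (a2 + c2 * \<nu> * (d a c)\<^sup>2) \<le> r * a2 + - \<kappa> * \<nu> * z\<^sup>2"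
        by (simp add: algebra_simps)
      then have "exp (- r * (v * (\<nu> * z\<^sup>2))) * exp (r * (a2 + c2 * \<nu> * (d a c)\<^sup>2))
          \<le> exp (r * a2) * exp (- \<kappa> * \<nu> * z\<^sup>2)"
        by (simp flip: exp_add)
      moreover have "exp (v * (\<nu> * z\<^sup>2)) * h \<le> exp (- (1 - \<rho>0) * a1) * exp (- \<kappa> * \<nu> * z\<^sup>2)"
      proof -
        have "\<kappa> * (\<nu> * z\<^sup>2) \<le> v * (\<nu> * z\<^sup>2)" using \<kappa>_le(1) nz by (intro mult_right_mono)
        then show ?thesis unfolding h_def by (simp add: algebra_simps flip: exp_add)
      qed
      ultimately show "exp (- r * (v * (\<nu> * z\<^sup>2))) * exp (r * (a2 + c2 * \<nu> * (d a c)\<^sup>2))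
          + exp (v * (\<nu> * z\<^sup>2)) * h \<le> C * exp (- \<kappa> * \<nu> * z\<^sup>2)"
        unfolding C r_def[symmetric] by (simp add: distrib_right)
    qed
    finally show ?thesis .
  qed
qed

text \<open>Where the posterior mass of \<open>U\<close> is large, the variational mass is bounded
  by one; elsewhere \<open>KL_div_ge\<close> applies. The measurable majorant \<open>k\<close> will
  be the infimum of the divergence over the variational family.\<close>

lemma variational_transfer:
  fixes \<Xi> :: "'y \<Rightarrow> 't measure" and k :: "'y \<Rightarrow> ereal" and t :: real
  assumes l: "l \<in> \<Lambda>" and U: "U \<in> sets S" and "t \<ge> 0"
    and \<Xi>_prob: "\<And>y. y \<in> space \<mu> \<Longrightarrow> prob_space (\<Xi> y)"
    and \<Xi>_meas: "(\<lambda>y. emeasure (\<Xi> y) U) \<in> borel_measurable \<mu>"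
    and k_meas: "k \<in> borel_measurable \<mu>"
    and KL: "\<And>y. y \<in> space \<mu> \<Longrightarrow> KL_div (\<Xi> y) (post y) \<le> k y"
  shows "ennreal t * (\<integral>\<^sup>+ y. emeasure (\<Xi> y) U \<partial>P l)
    \<le> ennreal t * emeasure (P l) {y \<in> space \<mu>. ennreal (exp (- t)) < emeasure (post y) U}
      + (\<integral>\<^sup>+ y. e2ennreal (k y) \<partial>P l) + ennreal (ln 2)"
proof -
  interpret Pl: prob_space "P l" by (rule P_prob[OF l])
  let ?A = "{y \<in> space \<mu>. ennreal (exp (- t)) < emeasure (post y) U}"
  have [measurable]: "?A \<in> sets \<mu>"
    \<comment> \<open>Only the measurability claim is extracted, at the dummy values
      \<open>F = {}\<close> and \<open>c = 1\<close>.\<close>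
    using posterior_tail(2)[OF l U sets.empty_sets, of 1 t] by simp
  note [measurable] = \<Xi>_meas k_meas q_meas[OF l]
  have "ennreal t * (\<integral>\<^sup>+ y. emeasure (\<Xi> y) U \<partial>P l) = (\<integral>\<^sup>+ y. ennreal t * emeasure (\<Xi> y) U \<partial>P l)"
    by (rule nn_integral_cmult[symmetric]) simp
  also have "\<dots> \<le> (\<integral>\<^sup>+ y. ennreal t * indicator ?A y + e2ennreal (k y) + ennreal (ln 2) \<partial>P l)"
  proof (rule nn_integral_mono_AE)
    \<comment> \<open>Almost everywhere is the best possible here: \<open>KL_div_ge\<close> requires
      the posterior to be a probability measure.\<close>
    have "AE y in \<mu>. ennreal t * emeasure (\<Xi> y) U \<le> ennreal t * indicator ?A y + e2ennreal (k y) + ennreal (ln 2)"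
      using prob_space_post AE_space
    proof eventually_elim
      case (elim y)
      interpret \<Xi>y: prob_space "\<Xi> y" by (rule \<Xi>_prob[OF elim(2)])
      show ?case
      proof (cases "y \<in> ?A")
        case True
        have "ennreal t * emeasure (\<Xi> y) U \<le> ennreal t * 1"
          by (intro mult_left_mono \<Xi>y.measure_le_1) auto
        also have "\<dots> \<le> ennreal t * 1 + (e2ennreal (k y) + ennreal (ln 2))" by simp
        finally show ?thesis using True by (simp add: add.assoc)
      next
        case False
        then have "emeasure (post y) U \<le> ennreal (exp (- t))" using elim by auto
        then have "ennreal t * emeasure (\<Xi> y) U \<le> e2ennreal (KL_div (\<Xi> y) (post y)) + ennreal (ln 2)"
          using elim U \<open>t \<ge> 0\<close> by (intro KL_div_ge \<Xi>y.prob_space_axioms) auto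
        also have "\<dots> \<le> e2ennreal (k y) + ennreal (ln 2)"
          using KL[OF elim(2)] by (intro add_right_mono e2ennreal_mono)
        finally show ?thesis using False by simp
      qed
    qed
    then have "AE y in \<mu>. 0 < ennreal (q l y) \<longrightarrow>
        ennreal t * emeasure (\<Xi> y) U \<le> ennreal t * indicator ?A y + e2ennreal (k y) + ennreal (ln 2)"
      by eventually_elim simp
    then show "AE y in P l. ennreal t * emeasure (\<Xi> y) U
        \<le> ennreal t * indicator ?A y + e2ennreal (k y) + ennreal (ln 2)"
      by (subst AE_density) auto
  qed
  also have "\<dots> = ennreal t * emeasure (P l) ?A + (\<integral>\<^sup>+ y. e2ennreal (k y) \<partial>P l) + ennreal (ln 2)"
    using Pl.emeasure_space_1 by (simp add: nn_integral_add nn_integral_cmult)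
  finally show ?thesis .
qed

end

section \<open>Posterior and variational contraction\<close>

text \<open>Since the square of \<open>j + 1\<close> is at least \<open>j + 1\<close>, a geometric
  series with ratio \<open>exp (- y) \<le> 1 / 2\<close> dominates; its sum is at most twice its
  first term.\<close>

lemma suminf_exp_square_le:
  fixes y C :: real
  assumes "y \<ge> 1" "C \<ge> 0"
  shows "(\<Sum>j. ennreal (C * exp (- y * (real (Suc j))\<^sup>2))) \<le> ennreal (2 * C * exp (- y))"
proof -
  let ?p = "exp (- y)"
  have "2 \<le> exp y" using exp_ge_add_one_self[of y] \<open>y \<ge> 1\<close> by linarith
  then have p: "?p \<le> 1 / 2" by (simp add: exp_minus field_simps)
  have "(\<Sum>j. ennreal (C * exp (- y * (real (Suc j))\<^sup>2))) \<le> (\<Sum>j. ennreal (C * ?p * ?p ^ j))"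
  proof (intro suminf_le)
    fix j
    have "real (Suc j) \<le> (real (Suc j))\<^sup>2" by (simp add: power2_eq_square)
    then have "y * real (Suc j) \<le> y * (real (Suc j))\<^sup>2" using \<open>y \<ge> 1\<close> by (intro mult_left_mono) auto
    then have "exp (- y * (real (Suc j))\<^sup>2) \<le> exp (real (Suc j) * - y)" by (simp add: mult.commute)
    also have "\<dots> = ?p * ?p ^ j" by (simp only: exp_of_nat_mult power_Suc)
    finally show "ennreal (C * exp (- y * (real (Suc j))\<^sup>2)) \<le> ennreal (C * ?p * ?p ^ j)"
      using \<open>C \<ge> 0\<close> by (intro ennreal_leI) (simp add: mult_left_mono mult.assoc)
  qed auto
  also have "\<dots> = ennreal (\<Sum>j. C * ?p * ?p ^ j)"
    using \<open>y \<ge> 1\<close> \<open>C \<ge> 0\<close> by (intro suminf_ennreal2 summable_mult summable_geometric) auto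
  also have "\<dots> \<le> ennreal (2 * C * ?p)"
  proof (rule ennreal_leI)
    have "1 - ?p \<ge> 1 / 2" using p by linarith
    then have "1 / (1 - ?p) \<le> 1 / (1 / 2)" by (intro divide_left_mono mult_pos_pos) linarith+
    then have "C * ?p * (1 / (1 - ?p)) \<le> C * ?p * 2" using \<open>C \<ge> 0\<close> by (intro mult_left_mono) auto
    moreover have "(\<Sum>j. C * ?p * ?p ^ j) = C * ?p * (1 / (1 - ?p))"
      using \<open>y \<ge> 1\<close> by (subst suminf_mult) (auto intro!: summable_geometric simp: suminf_geometric)
    ultimately show "(\<Sum>j. C * ?p * ?p ^ j) \<le> 2 * C * ?p" by simp
  qed
  finally show ?thesis .
qed

text \<open>Exponents are counted in units of \<open>X = Lf * (\<nu> * \<epsilon>\<^sup>2)\<close>.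
  The constant \<open>c0\<close> is the price of the evidence: \<open>4 * b0 + cZ\<close> for the
  weight of model \<open>m\<close>, \<open>4 * cD\<close> for its prior mass near the truth and
  \<open>4 * c2 + 1\<close> for the likelihood ratio, where each \<open>4\<close> is the square of
  the \<open>2\<close> in \<open>\<zeta> m \<le> 2 * \<epsilon>\<close> and
  \<open>rm \<le> 2 * \<epsilon>\<close>. \<open>G\<close> and \<open>H\<close> push the weight of
  the large models and the errors of the tests below a multiple of
  \<open>exp (- (K + c0 + 1) * X)\<close>, which leaves one unit of decay.\<close>

lemma (in mixture_model) posterior_tail_exponential:
  fixes d :: "'l \<Rightarrow> 'l \<Rightarrow> real" and \<nu> \<epsilon> Lf H G K Z :: real
  assumes l: "l \<in> \<Lambda>"
    and nonneg: "\<And>a b. a \<in> \<Lambda> \<Longrightarrow> b \<in> \<Lambda> \<Longrightarrow> d a b \<ge> 0"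
    and triangle: "\<And>a b c. a \<in> \<Lambda> \<Longrightarrow> b \<in> \<Lambda> \<Longrightarrow> c \<in> \<Lambda> \<Longrightarrow> d a c \<le> d a b + d b c"
    and sym: "\<And>a b. a \<in> \<Lambda> \<Longrightarrow> b \<in> \<Lambda> \<Longrightarrow> d a b = d b a"
    and U: "\<And>R. {\<theta> \<in> space S. R \<le> d (T \<theta>) l} \<in> sets S"
    and \<rho>0: "0 < \<rho>0" "\<rho>0 < 1" and \<rho>p: "\<rho>p > 1" and "c1 > 0" "c2 > 0" "\<nu> \<ge> 0"
    and lower: "\<And>a b. a \<in> \<Lambda> \<Longrightarrow> b \<in> \<Lambda> \<Longrightarrow> ereal (a1 + c1 * \<nu> * (d a b)\<^sup>2) \<le> renyi_div \<rho>0 (P a) (P b)"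
    and upper: "\<And>a b. a \<in> \<Lambda> \<Longrightarrow> b \<in> \<Lambda> \<Longrightarrow> renyi_div \<rho>p (P a) (P b) \<le> ereal (a2 + c2 * \<nu> * (d a b)\<^sup>2)"
    and v: "v = (1 - \<rho>0) * c1 / 8" and u: "c2 * u\<^sup>2 \<le> v / 2" "u \<le> 1 / 2"
    and \<kappa>: "\<kappa> = min ((\<rho>p - 1) * (v / 2)) v"
    and C: "C = exp ((\<rho>p - 1) * a2) + exp (- (1 - \<rho>0) * a1)"
    and cover: "\<And>m z. m \<in> I \<Longrightarrow> z > \<zeta> m \<Longrightarrow> \<exists>F. finite F \<and> F \<subseteq> \<Theta> m \<and> real (card F) \<le> exp (cu * \<nu> * (\<zeta> m)\<^sup>2) \<and>
        (\<forall>\<theta>\<in>\<Theta> m. d (T \<theta>) l \<le> 2 * z \<longrightarrow> (\<exists>c\<in>F. d (T c) (T \<theta>) \<le> u * z))"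
    and m: "m \<in> I" and \<zeta>m: "0 \<le> \<zeta> m" "\<zeta> m \<le> 2 * \<epsilon>" and rm: "rm \<le> 2 * \<epsilon>"
    and prior_mass: "ennreal (exp (- cD * \<nu> * (\<zeta> m)\<^sup>2)) \<le> emeasure (Q m) {\<theta> \<in> space S. d (T \<theta>) l \<le> rm}"
    and w: "\<And>m. w m = exp (- b0 * Lf * \<nu> * (\<zeta> m)\<^sup>2) / Z"
    and Z: "Z > 0" "Z \<le> exp (cZ * (\<nu> * \<epsilon>\<^sup>2))" "exp (- b0 * Lf * \<nu> * (\<zeta> m)\<^sup>2) \<le> Z"
    and large: "(\<integral>\<^sup>+ m. ennreal (exp (- b0 * Lf * \<nu> * (\<zeta> m)\<^sup>2)) \<partial>count_space {m \<in> I. G * \<epsilon> \<le> \<zeta> m})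
        \<le> ennreal (exp ((cL - b0 * G\<^sup>2) * (Lf * (\<nu> * \<epsilon>\<^sup>2))))"
    and small: "(\<integral>\<^sup>+ m. ennreal (exp (cu * \<nu> * (\<zeta> m)\<^sup>2)) \<partial>count_space {m \<in> I. \<zeta> m < G * \<epsilon>})
        \<le> ennreal (exp (cS * (\<nu> * \<epsilon>\<^sup>2)))"
    and "b0 \<ge> 0" "cD \<ge> 0" "cZ \<ge> 0" "cS \<ge> 0" "K \<ge> 0" "Lf \<ge> 1" "\<nu> * \<epsilon>\<^sup>2 \<ge> 1" "\<epsilon> > 0" "G \<le> H" "H > 0"
    and c0: "c0 = 4 * b0 + 4 * cD + 4 * c2 + 1 + cZ"
    and G: "b0 * G\<^sup>2 \<ge> K + c0 + cL + 4 * b0 + 1"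
    and H: "\<kappa> * H\<^sup>2 \<ge> K + c0 + 1 + cS"
  shows "emeasure (P l) {y \<in> space \<mu>. ennreal (exp (- (K * (Lf * (\<nu> * \<epsilon>\<^sup>2)))))
        < emeasure (post y) {\<theta> \<in> space S. H * sqrt Lf * \<epsilon> \<le> d (T \<theta>) l}}
    \<le> ennreal (2 * (exp ((\<rho>p - 1) * a2) * exp (- (\<rho>p - 1) * (\<nu> * \<epsilon>\<^sup>2))) + (4 * C + 2) * exp (- (\<nu> * \<epsilon>\<^sup>2)))"
proof -
  define x where "x = \<nu> * \<epsilon>\<^sup>2"
  define X where "X = Lf * x"
  have x: "x \<ge> 1" using assms by (simp add: x_def)
  have xX: "x \<le> X" using \<open>Lf \<ge> 1\<close> x by (simp add: X_def)
  then have X: "X \<ge> 1" using x by simp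
  define R where "R = H * sqrt Lf * \<epsilon>"
  have R: "R > 0" using \<open>H > 0\<close> \<open>Lf \<ge> 1\<close> \<open>\<epsilon> > 0\<close> by (simp add: R_def)
  \<comment> \<open>The factor \<open>sqrt Lf\<close> in the radius acts here: it raises the
    exponent of the tests from \<open>x\<close> to the scale \<open>X\<close> of the evidence
    bound.\<close>
  have \<nu>R: "\<nu> * R\<^sup>2 = H\<^sup>2 * X"
    using \<open>Lf \<ge> 1\<close> by (simp add: R_def X_def x_def power_mult_distrib)
  \<comment> \<open>Guarantees that for models in \<open>J\<close> every shell radius exceeds
    \<open>\<zeta>\<close>, the range in which \<open>cover\<close> provides coverings.\<close>
  have GR: "G * \<epsilon> \<le> R"
  proof -
    have "G * \<epsilon> \<le> H * \<epsilon>" using \<open>G \<le> H\<close> \<open>\<epsilon> > 0\<close> by simp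
    also have "\<dots> \<le> sqrt Lf * (H * \<epsilon>)"
      using \<open>Lf \<ge> 1\<close> \<open>H > 0\<close> \<open>\<epsilon> > 0\<close> by (intro mult_right_mono[of 1 "sqrt Lf" "H * \<epsilon>", simplified]) auto
    finally show ?thesis by (simp add: R_def ac_simps)
  qed
  define r where "r = \<rho>p - 1"
  have r: "r > 0" using \<rho>p by (simp add: r_def)
  have v_pos: "v > 0" unfolding v using \<rho>0 \<open>c1 > 0\<close> by simp
  have \<kappa>_pos: "\<kappa> > 0" using v_pos r by (simp add: \<kappa> r_def)
  have C_pos: "C > 0" unfolding C by (intro add_pos_pos) auto
  have c0_pos: "c0 \<ge> 1" using assms by (simp add: c0)
  define J where "J = {m \<in> I. \<zeta> m < G * \<epsilon>}"
  define g where "g z = ennreal (C * exp (- \<kappa> * \<nu> * z\<^sup>2))" for z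
  \<comment> \<open>The part \<open>4 * c2 * X\<close> dominates the divergence at distance
    \<open>2 * \<epsilon>\<close> up to its additive constant; the extra \<open>X\<close> yields the
    decay in Markov's inequality.\<close>
  define \<tau> where "\<tau> = (4 * c2 + 1) * X"
  define e where "e = exp (r * a2) * exp (- r * x)"
  \<comment> \<open>The intersection with \<open>\<Theta> m\<close> loses no \<open>Q m\<close>-mass
    and ensures that \<open>T \<theta>\<close> lies in \<open>\<Lambda>\<close>.\<close>
  define B where "B = {\<theta> \<in> space S. d (T \<theta>) l \<le> rm} \<inter> \<Theta> m"
  have d_meas: "(\<lambda>\<theta>. d (T \<theta>) l) \<in> borel_measurable S"
    using U by (simp add: borel_measurable_iff_ge)
  have ball: "{\<theta> \<in> space S. d (T \<theta>) l \<le> rm} \<in> sets S"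
    using d_meas by measurable
  then have B_sets: "B \<in> sets S" using \<Theta>_sets[OF m] by (auto simp: B_def)
  interpret Qm: prob_space "Q m" by (rule Q_prob[OF m])
  have nz: "\<nu> * (\<zeta> m)\<^sup>2 \<le> 4 * x"
  proof -
    have "(\<zeta> m)\<^sup>2 \<le> (2 * \<epsilon>)\<^sup>2" using \<zeta>m by (intro power_mono) auto
    then have "\<nu> * (\<zeta> m)\<^sup>2 \<le> \<nu> * (2 * \<epsilon>)\<^sup>2" using \<open>\<nu> \<ge> 0\<close> by (rule mult_left_mono)
    then show ?thesis by (simp add: x_def power2_eq_square)
  qed
  have B_mass: "exp (- 4 * cD * X) \<le> measure (Q m) B"
  proof -
    have "emeasure (Q m) {\<theta> \<in> space S. d (T \<theta>) l \<le> rm} = emeasure (Q m) B"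
      using Q_AE[OF m] ball B_sets Q_sets[OF m] by (intro emeasure_eq_AE) (auto simp: B_def)
    with prior_mass have "exp (- cD * \<nu> * (\<zeta> m)\<^sup>2) \<le> measure (Q m) B"
      by (simp add: Qm.emeasure_eq_measure)
    moreover have "cD * (\<nu> * (\<zeta> m)\<^sup>2) \<le> cD * (4 * X)"
      using nz xX \<open>cD \<ge> 0\<close> by (intro mult_left_mono) auto
    then have "exp (- 4 * cD * X) \<le> exp (- cD * \<nu> * (\<zeta> m)\<^sup>2)" by (simp add: algebra_simps)
    ultimately show ?thesis by linarith
  qed
  \<comment> \<open>\<open>Z\<close> is used from both sides: its upper bound keeps the weight of
    \<open>m\<close> from being too small, and its lower bound, the summand of \<open>m\<close>
    itself, keeps the weights of the large models from being too big.\<close>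
  have wm: "exp (- (4 * b0 + cZ) * X) \<le> w m" and Z_inv: "1 / Z \<le> exp (4 * b0 * X)"
  proof -
    have "b0 * Lf * (\<nu> * (\<zeta> m)\<^sup>2) \<le> b0 * Lf * (4 * x)"
      using nz \<open>b0 \<ge> 0\<close> \<open>Lf \<ge> 1\<close> by (intro mult_left_mono) auto
    then have *: "exp (- 4 * b0 * X) \<le> exp (- b0 * Lf * \<nu> * (\<zeta> m)\<^sup>2)" by (simp add: X_def algebra_simps)
    have "cZ * x \<le> cZ * X" using xX \<open>cZ \<ge> 0\<close> by (rule mult_left_mono)
    then have "Z \<le> exp (cZ * X)" using Z(2) unfolding x_def[symmetric] by (meson exp_le_cancel_iff order_trans)
    then have "exp (- 4 * b0 * X) / exp (cZ * X) \<le> w m"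
      unfolding w using * Z(1) by (intro frac_le) auto
    moreover have "exp (- 4 * b0 * X) / exp (cZ * X) = exp (- (4 * b0 + cZ) * X)"
      by (simp add: algebra_simps flip: exp_diff)
    ultimately show "exp (- (4 * b0 + cZ) * X) \<le> w m" by simp
    have "exp (- 4 * b0 * X) \<le> Z" using * Z(3) by linarith
    then have "1 / Z \<le> 1 / exp (- 4 * b0 * X)" using Z(1) by (intro divide_left_mono) auto
    then show "1 / Z \<le> exp (4 * b0 * X)" by (simp add: exp_minus field_simps)
  qed
  have wm_pos: "w m > 0" using wm exp_gt_zero less_le_trans by blast
  have B_pos: "measure (Q m) B > 0" using B_mass exp_gt_zero less_le_trans by blast
  have B_err: "emeasure (P l) {y \<in> space \<mu>. q (T \<theta>) y \<le> exp (- \<tau>) * q l y} \<le> ennreal e"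
    if \<theta>: "\<theta> \<in> B" for \<theta>
  proof -
    have T\<theta>: "T \<theta> \<in> \<Lambda>" using \<theta> T_range[OF m] by (simp add: B_def)
    interpret lt: positive_density_pair \<mu> "q l" "q (T \<theta>)" by (rule positive_density_pairI[OF l T\<theta>])
    have "d l (T \<theta>) \<le> 2 * \<epsilon>" using \<theta> rm sym[OF l T\<theta>] by (simp add: B_def)
    then have "(d l (T \<theta>))\<^sup>2 \<le> (2 * \<epsilon>)\<^sup>2" using nonneg[OF l T\<theta>] by (intro power_mono) auto
    then have "c2 * \<nu> * (d l (T \<theta>))\<^sup>2 \<le> c2 * \<nu> * (2 * \<epsilon>)\<^sup>2"
      using \<open>\<nu> \<ge> 0\<close> \<open>c2 > 0\<close> by (intro mult_left_mono) auto
    also have "\<dots> = 4 * c2 * x" by (simp add: x_def power2_eq_square)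
    also have "\<dots> \<le> 4 * c2 * X" using xX \<open>c2 > 0\<close> by simp
    finally have "r * (c2 * \<nu> * (d l (T \<theta>))\<^sup>2) \<le> r * (4 * c2 * X)" using r by simp
    moreover have "r * x \<le> r * X" using xX r by simp
    ultimately have *: "- r * \<tau> + r * (a2 + c2 * \<nu> * (d l (T \<theta>))\<^sup>2) \<le> r * a2 + - r * x"
      by (simp add: \<tau>_def algebra_simps)
    have "{y \<in> space \<mu>. q (T \<theta>) y \<le> exp (- \<tau>) * q l y} = {y \<in> space \<mu>. exp \<tau> * q (T \<theta>) y \<le> q l y}"
      by (auto simp: exp_minus field_simps)
    then have "emeasure (P l) {y \<in> space \<mu>. q (T \<theta>) y \<le> exp (- \<tau>) * q l y}
        \<le> ennreal (exp (- r * \<tau>)) * lt.power_integral r"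
      using lt.density_ratio_tail[OF r, of \<tau>] by simp
    also have "\<dots> \<le> ennreal (exp (- r * \<tau>)) * ennreal (exp (r * (a2 + c2 * \<nu> * (d l (T \<theta>))\<^sup>2)))"
      using lt.power_integral_le[of \<rho>p "a2 + c2 * \<nu> * (d l (T \<theta>))\<^sup>2"] upper[OF l T\<theta>] \<rho>p
      by (intro mult_left_mono) (auto simp: r_def)
    also have "\<dots> = ennreal (exp (- r * \<tau> + r * (a2 + c2 * \<nu> * (d l (T \<theta>))\<^sup>2)))"
      by (subst ennreal_mult[symmetric]) (simp_all only: exp_add exp_ge_zero)
    also have "\<dots> \<le> ennreal e"
      using * unfolding e_def by (intro ennreal_leI) (simp flip: exp_add)
    finally show ?thesis .
  qed
  note lr = likelihood_ratio_test_bounds[OF l \<rho>0 \<rho>p \<open>c1 > 0\<close> \<open>c2 > 0\<close> \<open>\<nu> \<ge> 0\<close> lower upper nonneg v u(1) \<kappa> C]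
  have bound: "emeasure (P l) {y \<in> space \<mu>. ennreal (exp (- (K * X))) < emeasure (post y) {\<theta> \<in> space S. R \<le> d (T \<theta>) l}}
    \<le> 2 * ennreal e + (\<integral>\<^sup>+ m. ennreal (exp (cu * \<nu> * (\<zeta> m)\<^sup>2)) \<partial>count_space J) * (\<Sum>j. g (real (Suc j) * R))
      + ennreal (exp (K * X) / (w m * (measure (Q m) B / 2) * exp (- \<tau>)))
        * (g R + (\<integral>\<^sup>+ m. ennreal (w m) \<partial>count_space (I - J)))"
  proof (rule posterior_tail_bound[OF l _ R u(2) triangle sym U _ _ _ _ m B_sets B_pos _ wm_pos B_err])
    show "J \<subseteq> I" by (auto simp: J_def)
    show "\<exists>F. finite F \<and> F \<subseteq> \<Theta> k \<and> real (card F) \<le> exp (cu * \<nu> * (\<zeta> k)\<^sup>2) \<and>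
        (\<forall>\<theta>\<in>\<Theta> k. d (T \<theta>) l \<le> 2 * z \<longrightarrow> (\<exists>c\<in>F. d (T c) (T \<theta>) \<le> u * z))"
      if "k \<in> J" "R \<le> z" for k z
      using that GR by (intro cover) (auto simp: J_def)
    show "emeasure (P l) {y \<in> space \<mu>. q l y \<le> q c y} \<le> g z"
      if "c \<in> \<Lambda>" "z \<ge> R" "z / 2 \<le> d l c" for c z
      unfolding g_def using that R by (intro lr(1)) auto
    show "emeasure (P a) {y \<in> space \<mu>. q c y \<le> q l y} \<le> g z"
      if "a \<in> \<Lambda>" "c \<in> \<Lambda>" "z \<ge> R" "z / 2 \<le> d l c" "d a c \<le> u * z" for a c z
      unfolding g_def using that R by (intro lr(2)) auto
    show "g z \<le> g R" if "z \<ge> R" for z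
    proof -
      have "R\<^sup>2 \<le> z\<^sup>2" using that R by (intro power_mono) auto
      then have "\<kappa> * \<nu> * R\<^sup>2 \<le> \<kappa> * \<nu> * z\<^sup>2" using \<kappa>_pos \<open>\<nu> \<ge> 0\<close> by (intro mult_left_mono) auto
      then show ?thesis unfolding g_def using C_pos by (intro ennreal_leI mult_left_mono) auto
    qed
  qed auto
  have \<kappa>X: "(K + c0 + 1 + cS) * X \<le> \<kappa> * \<nu> * R\<^sup>2"
    using mult_right_mono[OF H, of X] X \<nu>R by (simp add: mult.assoc)
  have "1 * 1 \<le> (K + c0 + 1 + cS) * X"
    using X c0_pos \<open>K \<ge> 0\<close> \<open>cS \<ge> 0\<close> by (intro mult_mono) auto
  then have y: "1 \<le> \<kappa> * \<nu> * R\<^sup>2" using \<kappa>X by linarith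
  have g_eq: "g (real (Suc j) * R) = ennreal (C * exp (- (\<kappa> * \<nu> * R\<^sup>2) * (real (Suc j))\<^sup>2))" for j
    unfolding g_def by (simp only: power_mult_distrib mult_minus_left mult_minus_right ac_simps)
  have "(\<Sum>j. g (real (Suc j) * R)) \<le> ennreal (2 * C * exp (- (\<kappa> * \<nu> * R\<^sup>2)))"
    unfolding g_eq using C_pos by (intro suminf_exp_square_le y) simp
  then have "(\<integral>\<^sup>+ m. ennreal (exp (cu * \<nu> * (\<zeta> m)\<^sup>2)) \<partial>count_space J) * (\<Sum>j. g (real (Suc j) * R))
      \<le> ennreal (exp (cS * x)) * ennreal (2 * C * exp (- (\<kappa> * \<nu> * R\<^sup>2)))"
    by (intro mult_mono small[folded J_def x_def]) simp_all
  also have "\<dots> = ennreal (exp (cS * x) * (2 * C * exp (- (\<kappa> * \<nu> * R\<^sup>2))))"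
    using C_pos by (intro ennreal_mult[symmetric]) auto
  also have "\<dots> \<le> ennreal (2 * C * exp (- x))"
  proof (rule ennreal_leI)
    \<comment> \<open>The summand \<open>cS\<close> in the condition on \<open>H\<close> pays for
      the total number of centres.\<close>
    have "cS * x \<le> cS * X" using xX \<open>cS \<ge> 0\<close> by (rule mult_left_mono)
    moreover have "0 \<le> (K + c0) * X" using \<open>K \<ge> 0\<close> c0_pos X by simp
    ultimately have "cS * x + - (\<kappa> * \<nu> * R\<^sup>2) \<le> - x" using \<kappa>X xX by (simp add: distrib_right)
    then have "exp (cS * x) * exp (- (\<kappa> * \<nu> * R\<^sup>2)) \<le> exp (- x)" by (simp flip: exp_add)
    then show "exp (cS * x) * (2 * C * exp (- (\<kappa> * \<nu> * R\<^sup>2))) \<le> 2 * C * exp (- x)"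
      using C_pos by (simp add: mult.left_commute)
  qed
  finally have part2: "(\<integral>\<^sup>+ m. ennreal (exp (cu * \<nu> * (\<zeta> m)\<^sup>2)) \<partial>count_space J) * (\<Sum>j. g (real (Suc j) * R))
      \<le> ennreal (2 * C * exp (- x))" .
  define E where "E = exp (- (K + c0 + 1) * X)"
  have "g R \<le> ennreal (C * E)"
  proof -
    have "0 \<le> cS * X" using \<open>cS \<ge> 0\<close> X by simp
    then have "(K + c0 + 1) * X \<le> \<kappa> * \<nu> * R\<^sup>2" using \<kappa>X by (simp add: distrib_right)
    then show ?thesis unfolding g_def E_def using C_pos
      by (intro ennreal_leI mult_left_mono) (auto simp: algebra_simps)
  qed
  moreover have "(\<integral>\<^sup>+ m. ennreal (w m) \<partial>count_space (I - J)) \<le> ennreal E"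
  proof -
    have IJ: "I - J = {m \<in> I. G * \<epsilon> \<le> \<zeta> m}" by (auto simp: J_def)
    have "(\<integral>\<^sup>+ m. ennreal (w m) \<partial>count_space (I - J))
        = (\<integral>\<^sup>+ m. ennreal (1 / Z) * ennreal (exp (- b0 * Lf * \<nu> * (\<zeta> m)\<^sup>2)) \<partial>count_space (I - J))"
      using Z(1) by (intro nn_integral_cong) (simp add: w flip: ennreal_mult)
    also have "\<dots> = ennreal (1 / Z) * (\<integral>\<^sup>+ m. ennreal (exp (- b0 * Lf * \<nu> * (\<zeta> m)\<^sup>2)) \<partial>count_space (I - J))"
      by (rule nn_integral_cmult) simp
    also have "\<dots> \<le> ennreal (exp (4 * b0 * X)) * ennreal (exp ((cL - b0 * G\<^sup>2) * X))"
      using large Z_inv unfolding IJ X_def x_def by (intro mult_mono ennreal_leI) auto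
    also have "\<dots> = ennreal (exp (4 * b0 * X + (cL - b0 * G\<^sup>2) * X))"
      by (simp add: exp_add ennreal_mult)
    also have "\<dots> \<le> ennreal E"
    proof -
      \<comment> \<open>The summand \<open>4 * b0\<close> in the condition on \<open>G\<close>
        compensates the factor \<open>1 / Z\<close>.\<close>
      have "4 * b0 + (cL - b0 * G\<^sup>2) \<le> - (K + c0 + 1)" using G by simp
      then have "(4 * b0 + (cL - b0 * G\<^sup>2)) * X \<le> - (K + c0 + 1) * X" using X by (intro mult_right_mono) auto
      then show ?thesis unfolding E_def by (intro ennreal_leI) (simp add: distrib_right)
    qed
    finally show ?thesis .
  qed
  ultimately have "g R + (\<integral>\<^sup>+ m. ennreal (w m) \<partial>count_space (I - J)) \<le> ennreal (C * E) + ennreal E"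
    by (rule add_mono)
  also have "\<dots> = ennreal ((C + 1) * E)"
    using C_pos by (simp add: E_def distrib_right)
  finally have gw: "g R + (\<integral>\<^sup>+ m. ennreal (w m) \<partial>count_space (I - J)) \<le> ennreal ((C + 1) * E)" .
  have ev: "exp (K * X) / (w m * (measure (Q m) B / 2) * exp (- \<tau>)) \<le> 2 * exp ((K + c0) * X)"
  proof -
    have "exp (- (4 * b0 + cZ) * X) * exp (- 4 * cD * X) \<le> w m * measure (Q m) B"
      using wm B_mass wm_pos by (intro mult_mono) auto
    then have "exp (- (4 * b0 + cZ) * X) * exp (- 4 * cD * X) * exp (- \<tau>) \<le> w m * measure (Q m) B * exp (- \<tau>)"
      by (intro mult_right_mono) auto
    also have "exp (- (4 * b0 + cZ) * X) * exp (- 4 * cD * X) * exp (- \<tau>) = exp (- (c0 * X))"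
      by (simp add: c0 \<tau>_def algebra_simps flip: exp_add)
    finally have "exp (- (c0 * X)) / 2 \<le> w m * (measure (Q m) B / 2) * exp (- \<tau>)" by simp
    then have "exp (K * X) / (w m * (measure (Q m) B / 2) * exp (- \<tau>)) \<le> exp (K * X) / (exp (- (c0 * X)) / 2)"
      using wm_pos B_pos by (intro divide_left_mono) auto
    also have "\<dots> = 2 * exp ((K + c0) * X)"
      by (simp add: exp_minus distrib_right exp_add field_simps)
    finally show ?thesis .
  qed
  have "ennreal (exp (K * X) / (w m * (measure (Q m) B / 2) * exp (- \<tau>)))
        * (g R + (\<integral>\<^sup>+ m. ennreal (w m) \<partial>count_space (I - J)))
      \<le> ennreal (2 * exp ((K + c0) * X)) * ennreal ((C + 1) * E)"
    using ev gw by (intro mult_mono ennreal_leI) auto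
  also have "\<dots> = ennreal (2 * (C + 1) * (exp ((K + c0) * X) * E))"
    using C_pos by (subst ennreal_mult[symmetric]) (auto simp: E_def ac_simps)
  \<comment> \<open>The loss \<open>c0\<close> from the evidence and the level \<open>K\<close> of
    the posterior tail cancel against \<open>E\<close>, up to the reserve of one unit.\<close>
  also have "exp ((K + c0) * X) * E = exp (- X)"
    unfolding E_def by (simp add: algebra_simps flip: exp_add)
  also have "ennreal (2 * (C + 1) * exp (- X)) \<le> ennreal (2 * (C + 1) * exp (- x))"
    using C_pos xX by (intro ennreal_leI mult_left_mono) auto
  finally have part3: "ennreal (exp (K * X) / (w m * (measure (Q m) B / 2) * exp (- \<tau>)))
        * (g R + (\<integral>\<^sup>+ m. ennreal (w m) \<partial>count_space (I - J)))
      \<le> ennreal (2 * (C + 1) * exp (- x))" .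
  have "emeasure (P l) {y \<in> space \<mu>. ennreal (exp (- (K * X))) < emeasure (post y) {\<theta> \<in> space S. R \<le> d (T \<theta>) l}}
      \<le> 2 * ennreal e + ennreal (2 * C * exp (- x)) + ennreal (2 * (C + 1) * exp (- x))"
    by (rule order_trans[OF bound]) (intro add_mono part2 part3 order_refl)
  also have "\<dots> = ennreal (2 * e + (4 * C + 2) * exp (- x))"
  proof -
    have "2 * ennreal e = ennreal (2 * e)" by (simp add: e_def ennreal_mult)
    then show ?thesis using C_pos by (simp add: e_def algebra_simps flip: ennreal_plus)
  qed
  finally show ?thesis by (simp only: e_def r_def X_def x_def R_def)
qed

section \<open>Sums of prior weights\<close>

lemma nn_integral_count_space_split:
  fixes f :: "'a \<Rightarrow> ennreal"
  shows "(\<integral>\<^sup>+ m. f m \<partial>count_space I)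
    = (\<integral>\<^sup>+ m. f m \<partial>count_space {m \<in> I. Q m}) + (\<integral>\<^sup>+ m. f m \<partial>count_space {m \<in> I. \<not> Q m})"
proof -
  have "(\<integral>\<^sup>+ m. f m \<partial>count_space I)
      = (\<integral>\<^sup>+ m. f m * indicator {m. Q m} m + f m * indicator {m. \<not> Q m} m \<partial>count_space I)"
    by (intro nn_integral_cong) (auto simp: indicator_def)
  also have "\<dots> = (\<integral>\<^sup>+ m. f m * indicator {m. Q m} m \<partial>count_space I)
      + (\<integral>\<^sup>+ m. f m * indicator {m. \<not> Q m} m \<partial>count_space I)"
    by (rule nn_integral_add) auto
  also have "\<dots> = (\<integral>\<^sup>+ m. f m \<partial>count_space {m \<in> I. Q m}) + (\<integral>\<^sup>+ m. f m \<partial>count_space {m \<in> I. \<not> Q m})"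
    by (intro arg_cong2[where f = "(+)"])
      (auto simp: nn_integral_count_space_indicator indicator_def intro!: nn_integral_cong)
  finally show ?thesis .
qed

text \<open>\<open>base\<close> is (C) at the fixed multiplier \<open>b0\<close>. For
  \<open>G * \<epsilon> \<le> \<zeta> m\<close> the surplus factor
  \<open>exp (- b0 * (Lf - 1) * \<nu> * (\<zeta> m)\<^sup>2)\<close> is at most its value
  \<open>?k\<close> at the cut and leaves the sum; \<open>cL \<ge> 0\<close> then permits replacing
  \<open>cL\<close> by \<open>cL * Lf\<close>.\<close>

lemma weight_integral_tail:
  fixes \<zeta> :: "'m \<Rightarrow> real" and \<nu> \<epsilon> Lf G b0 cL :: real
  assumes base: "(\<integral>\<^sup>+ m. ennreal (exp (- b0 * \<nu> * (\<zeta> m)\<^sup>2)) \<partial>count_space {m \<in> I. G * \<epsilon> \<le> \<zeta> m})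
      \<le> ennreal (exp ((cL - b0 * G\<^sup>2) * \<nu> * \<epsilon>\<^sup>2))"
    and "Lf \<ge> 1" "b0 \<ge> 0" "\<nu> \<ge> 0" "cL \<ge> 0" "G \<ge> 0" "\<epsilon> \<ge> 0"
  shows "(\<integral>\<^sup>+ m. ennreal (exp (- b0 * Lf * \<nu> * (\<zeta> m)\<^sup>2)) \<partial>count_space {m \<in> I. G * \<epsilon> \<le> \<zeta> m})
    \<le> ennreal (exp ((cL - b0 * G\<^sup>2) * (Lf * (\<nu> * \<epsilon>\<^sup>2))))"
proof -
  let ?k = "exp (- b0 * (Lf - 1) * \<nu> * (G * \<epsilon>)\<^sup>2)"
  let ?I = "{m \<in> I. G * \<epsilon> \<le> \<zeta> m}"
  have "(\<integral>\<^sup>+ m. ennreal (exp (- b0 * Lf * \<nu> * (\<zeta> m)\<^sup>2)) \<partial>count_space ?I)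
      \<le> (\<integral>\<^sup>+ m. ennreal ?k * ennreal (exp (- b0 * \<nu> * (\<zeta> m)\<^sup>2)) \<partial>count_space ?I)"
  proof (rule nn_integral_mono)
    fix m assume "m \<in> space (count_space ?I)"
    then have "(G * \<epsilon>)\<^sup>2 \<le> (\<zeta> m)\<^sup>2" using assms by (intro power_mono) auto
    then have "b0 * (Lf - 1) * \<nu> * (G * \<epsilon>)\<^sup>2 \<le> b0 * (Lf - 1) * \<nu> * (\<zeta> m)\<^sup>2"
      using assms by (intro mult_left_mono) auto
    then have "exp (- b0 * Lf * \<nu> * (\<zeta> m)\<^sup>2) \<le> ?k * exp (- b0 * \<nu> * (\<zeta> m)\<^sup>2)"
      by (simp add: algebra_simps flip: exp_add)
    then show "ennreal (exp (- b0 * Lf * \<nu> * (\<zeta> m)\<^sup>2)) \<le> ennreal ?k * ennreal (exp (- b0 * \<nu> * (\<zeta> m)\<^sup>2))"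
      by (subst ennreal_mult[symmetric]) (auto intro: ennreal_leI)
  qed
  also have "\<dots> = ennreal ?k * (\<integral>\<^sup>+ m. ennreal (exp (- b0 * \<nu> * (\<zeta> m)\<^sup>2)) \<partial>count_space ?I)"
    by (rule nn_integral_cmult) simp
  also have "\<dots> \<le> ennreal ?k * ennreal (exp ((cL - b0 * G\<^sup>2) * \<nu> * \<epsilon>\<^sup>2))"
    by (intro mult_left_mono base) simp
  also have "\<dots> = ennreal (exp (- b0 * (Lf - 1) * \<nu> * (G * \<epsilon>)\<^sup>2 + (cL - b0 * G\<^sup>2) * \<nu> * \<epsilon>\<^sup>2))"
    by (subst ennreal_mult[symmetric]) (simp_all only: exp_add exp_ge_zero)
  also have "\<dots> \<le> ennreal (exp ((cL - b0 * G\<^sup>2) * (Lf * (\<nu> * \<epsilon>\<^sup>2))))"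
  proof (intro ennreal_leI, subst exp_le_cancel_iff)
    have "cL * (\<nu> * \<epsilon>\<^sup>2) * 1 \<le> cL * (\<nu> * \<epsilon>\<^sup>2) * Lf"
      using assms by (intro mult_left_mono) auto
    then show "- b0 * (Lf - 1) * \<nu> * (G * \<epsilon>)\<^sup>2 + (cL - b0 * G\<^sup>2) * \<nu> * \<epsilon>\<^sup>2
        \<le> (cL - b0 * G\<^sup>2) * (Lf * (\<nu> * \<epsilon>\<^sup>2))"
      by (simp add: power_mult_distrib algebra_simps)
  qed
  finally show ?thesis .
qed

text \<open>For an upper bound the factor \<open>Lf \<ge> 1\<close> may be dropped, and on the small
  models the negative exponent may even be replaced by a positive one, which brings in the second
  sum of (C) at multiplier one. The \<open>+ 1\<close> absorbs the addition of two exponentials,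
  since \<open>\<nu> * \<epsilon>\<^sup>2 \<ge> 1\<close>.\<close>

lemma weight_integral_total:
  fixes \<zeta> :: "'m \<Rightarrow> real" and \<nu> \<epsilon> Lf b0 cL cS :: real
  assumes large: "(\<integral>\<^sup>+ m. ennreal (exp (- b0 * \<nu> * (\<zeta> m)\<^sup>2)) \<partial>count_space {m \<in> I. G * \<epsilon> \<le> \<zeta> m})
      \<le> ennreal (exp ((cL - b0 * G\<^sup>2) * \<nu> * \<epsilon>\<^sup>2))"
    and small: "(\<integral>\<^sup>+ m. ennreal (exp (\<nu> * (\<zeta> m)\<^sup>2)) \<partial>count_space {m \<in> I. \<zeta> m < G * \<epsilon>})
      \<le> ennreal (exp (cS * \<nu> * \<epsilon>\<^sup>2))"
    and "Lf \<ge> 1" "b0 \<ge> 0" "cL \<ge> 0" "cS \<ge> 0" and x: "\<nu> * \<epsilon>\<^sup>2 \<ge> 1" and \<nu>: "\<nu> \<ge> 0"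
  shows "(\<integral>\<^sup>+ m. ennreal (exp (- b0 * Lf * \<nu> * (\<zeta> m)\<^sup>2)) \<partial>count_space I)
    \<le> ennreal (exp ((cL + cS + 1) * (\<nu> * \<epsilon>\<^sup>2)))"
proof -
  define x where "x = \<nu> * \<epsilon>\<^sup>2"
  have pw: "ennreal (exp (- b0 * Lf * \<nu> * (\<zeta> m)\<^sup>2)) \<le> ennreal (exp (- b0 * \<nu> * (\<zeta> m)\<^sup>2))"
    "ennreal (exp (- b0 * Lf * \<nu> * (\<zeta> m)\<^sup>2)) \<le> ennreal (exp (\<nu> * (\<zeta> m)\<^sup>2))" for m
  proof -
    have "(b0 * \<nu> * (\<zeta> m)\<^sup>2) * 1 \<le> (b0 * \<nu> * (\<zeta> m)\<^sup>2) * Lf"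
      using assms by (intro mult_left_mono) auto
    moreover have "0 \<le> b0 * \<nu> * (\<zeta> m)\<^sup>2" "0 \<le> \<nu> * (\<zeta> m)\<^sup>2" using assms by auto
    ultimately show "ennreal (exp (- b0 * Lf * \<nu> * (\<zeta> m)\<^sup>2)) \<le> ennreal (exp (- b0 * \<nu> * (\<zeta> m)\<^sup>2))"
      "ennreal (exp (- b0 * Lf * \<nu> * (\<zeta> m)\<^sup>2)) \<le> ennreal (exp (\<nu> * (\<zeta> m)\<^sup>2))"
      by (auto intro!: ennreal_leI simp: algebra_simps)
  qed
  have neg: "{m \<in> I. \<not> G * \<epsilon> \<le> \<zeta> m} = {m \<in> I. \<zeta> m < G * \<epsilon>}" by auto
  have "(\<integral>\<^sup>+ m. ennreal (exp (- b0 * Lf * \<nu> * (\<zeta> m)\<^sup>2)) \<partial>count_space I)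
      \<le> (\<integral>\<^sup>+ m. ennreal (exp (- b0 * \<nu> * (\<zeta> m)\<^sup>2)) \<partial>count_space {m \<in> I. G * \<epsilon> \<le> \<zeta> m})
        + (\<integral>\<^sup>+ m. ennreal (exp (\<nu> * (\<zeta> m)\<^sup>2)) \<partial>count_space {m \<in> I. \<zeta> m < G * \<epsilon>})"
    by (subst nn_integral_count_space_split[where Q = "\<lambda>m. G * \<epsilon> \<le> \<zeta> m"], unfold neg)
      (intro add_mono nn_integral_mono pw)
  also have "\<dots> \<le> ennreal (exp ((cL - b0 * G\<^sup>2) * \<nu> * \<epsilon>\<^sup>2)) + ennreal (exp (cS * \<nu> * \<epsilon>\<^sup>2))"
    by (intro add_mono large small)
  also have "\<dots> = ennreal (exp ((cL - b0 * G\<^sup>2) * x) + exp (cS * x))"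
    by (simp add: x_def mult.assoc)
  also have "\<dots> \<le> ennreal (exp ((cL + cS + 1) * x))"
  proof (rule ennreal_leI)
    have x1: "x \<ge> 1" using x by (simp add: x_def)
    have "exp ((cL - b0 * G\<^sup>2) * x) \<le> exp ((cL + cS) * x)"
    proof (subst exp_le_cancel_iff, rule mult_right_mono)
      have "0 \<le> b0 * G\<^sup>2" using \<open>b0 \<ge> 0\<close> by simp
      then show "cL - b0 * G\<^sup>2 \<le> cL + cS" using \<open>cS \<ge> 0\<close> by linarith
    qed (use x1 in simp)
    moreover have "exp (cS * x) \<le> exp ((cL + cS) * x)"
      using assms x1 by simp
    moreover have "exp ((cL + cS) * x) * 2 \<le> exp ((cL + cS) * x) * exp x"
      using exp_ge_add_one_self[of x] x1 by (intro mult_left_mono) (linarith, simp)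
    moreover have "exp ((cL + cS + 1) * x) = exp ((cL + cS) * x) * exp x"
      by (simp add: distrib_right exp_add)
    ultimately show "exp ((cL - b0 * G\<^sup>2) * x) + exp (cS * x) \<le> exp ((cL + cS + 1) * x)"
      by linarith
  qed
  finally show ?thesis by (simp add: x_def)
qed

section \<open>Choice of the constants and passage to the limit\<close>

theorem theorem3p6:
  fixes \<mu> :: "nat \<Rightarrow> 'y measure"
    and \<Lambda> \<Lambda>s :: "nat \<Rightarrow> 'l set"
    and d :: "nat \<Rightarrow> 'l \<Rightarrow> 'l \<Rightarrow> real"
    and q :: "nat \<Rightarrow> 'l \<Rightarrow> 'y \<Rightarrow> real"
    and P :: "nat \<Rightarrow> 'l \<Rightarrow> 'y measure"
    and M :: "nat \<Rightarrow> 'm set"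
    and S :: "nat \<Rightarrow> 't measure"
    and \<Theta> :: "nat \<Rightarrow> 'm \<Rightarrow> 't set"
    and T :: "nat \<Rightarrow> 't \<Rightarrow> 'l"
    and \<Pi>m :: "nat \<Rightarrow> 'm \<Rightarrow> 't measure"
    and V :: "nat \<Rightarrow> 'm \<Rightarrow> 't measure set"
    and \<Xi>hat :: "nat \<Rightarrow> 'y \<Rightarrow> 't measure"
    and \<eta> \<zeta> :: "nat \<Rightarrow> 'm \<Rightarrow> real"
    and \<epsilon> :: "nat \<Rightarrow> real"
    and L :: "nat \<Rightarrow> real"
    and b0 :: real
    and A :: "nat \<Rightarrow> real"
  \<comment> \<open>standing setting\<close>
  assumes sigma_fin: "\<And>n. sigma_finite_measure (\<mu> n)"
    and metric: "\<And>n x y z. x \<in> \<Lambda> n \<Longrightarrow> y \<in> \<Lambda> n \<Longrightarrow> z \<in> \<Lambda> n \<Longrightarrow>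
                   d n x y \<ge> 0 \<and> (d n x y = 0 \<longleftrightarrow> x = y) \<and> d n x y = d n y x
                   \<and> d n x z \<le> d n x y + d n y z"
    and q_pos: "\<And>n l y. l \<in> \<Lambda> n \<Longrightarrow> y \<in> space (\<mu> n) \<Longrightarrow> q n l y > 0"
    and q_meas: "\<And>n l. l \<in> \<Lambda> n \<Longrightarrow> q n l \<in> borel_measurable (\<mu> n)"
    and P_def: "\<And>n l. P n l = density (\<mu> n) (\<lambda>y. ennreal (q n l y))"
    and P_prob: "\<And>n l. l \<in> \<Lambda> n \<Longrightarrow> prob_space (P n l)"
    and M_countable: "\<And>n. countable (M n)"
    and M_nonempty: "\<And>n. M n \<noteq> {}"
    and \<Theta>_sets: "\<And>n m. m \<in> M n \<Longrightarrow> \<Theta> n m \<in> sets (S n)"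
    and T_range: "\<And>n m \<theta>. m \<in> M n \<Longrightarrow> \<theta> \<in> \<Theta> n m \<Longrightarrow> T n \<theta> \<in> \<Lambda> n"
    and lik_meas: "\<And>n. (\<lambda>(\<theta>, y). q n (T n \<theta>) y) \<in> borel_measurable (S n \<Otimes>\<^sub>M \<mu> n)"
    and \<Pi>m_prob: "\<And>n m. m \<in> M n \<Longrightarrow> prob_space (\<Pi>m n m) \<and> sets (\<Pi>m n m) = sets (S n)
                          \<and> emeasure (\<Pi>m n m) (\<Theta> n m) = 1"
    and V_sub: "\<And>n m \<Xi>. m \<in> M n \<Longrightarrow> \<Xi> \<in> V n m \<Longrightarrow>
                   prob_space \<Xi> \<and> sets \<Xi> = sets (S n) \<and> emeasure \<Xi> (\<Theta> n m) = 1"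
    and \<Lambda>s_sub: "\<And>n. \<Lambda>s n \<subseteq> \<Lambda> n"
    and \<eta>_pos: "\<And>n m. m \<in> M n \<Longrightarrow> \<eta> n m > 0"
    and \<zeta>_pos: "\<And>n m. m \<in> M n \<Longrightarrow> \<zeta> n m > 0"
    and L_ge: "\<And>n. L n \<ge> 1"
    and b0_pos: "b0 > 0"
  \<comment> \<open>the variational posterior is a KL-minimiser over the variational family\<close>
    and \<Xi>hat_min: "\<And>n y. y \<in> space (\<mu> n) \<Longrightarrow>
          \<Xi>hat n y \<in> var_family (S n) (M n) (V n) \<and>
          (\<forall>\<Xi>\<in>var_family (S n) (M n) (V n).
             KL_div (\<Xi>hat n y) (posterior (mixture (S n) (M n) (prior_weight b0 (L n) n (M n) (\<zeta> n)) (\<Pi>m n))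
                                    (\<lambda>\<theta> y. q n (T n \<theta>) y) y)
             \<le> KL_div \<Xi> (posterior (mixture (S n) (M n) (prior_weight b0 (L n) n (M n) (\<zeta> n)) (\<Pi>m n))
                                    (\<lambda>\<theta> y. q n (T n \<theta>) y) y))"
  \<comment> \<open>measurability (implicit in the paper)\<close>
    and ball_meas: "\<And>n l r. {\<theta> \<in> space (S n). d n (T n \<theta>) l \<ge> r} \<in> sets (S n)"
    and \<Xi>hat_meas: "\<And>n l r. (\<lambda>y. emeasure (\<Xi>hat n y) {\<theta> \<in> space (S n). d n (T n \<theta>) l \<ge> r})
                              \<in> borel_measurable (\<mu> n)"
    and infKL_meas: "\<And>n. (\<lambda>y. INF \<Xi>\<in>var_family (S n) (M n) (V n).
             KL_div \<Xi> (posterior (mixture (S n) (M n) (prior_weight b0 (L n) n (M n) (\<zeta> n)) (\<Pi>m n))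
                                  (\<lambda>\<theta> y. q n (T n \<theta>) y) y)) \<in> borel_measurable (\<mu> n)"
  \<comment> \<open>(A)\<close>
    and condA: "\<exists>\<rho>0 \<rho>p a1 a2 c1 c2. 0 < \<rho>0 \<and> \<rho>0 < 1 \<and> \<rho>p > 1 \<and> a2 \<ge> a1 \<and> c2 \<ge> c1 \<and> c1 > 0 \<and>
          (\<forall>\<^sub>F n in sequentially. \<forall>l0\<in>\<Lambda> n. \<forall>l1\<in>\<Lambda> n.
              ereal (a1 + c1 * real n * (d n l0 l1)\<^sup>2) \<le> renyi_div \<rho>0 (P n l0) (P n l1) \<and>
              renyi_div \<rho>p (P n l0) (P n l1) \<le> ereal (a2 + c2 * real n * (d n l0 l1)\<^sup>2))"
  \<comment> \<open>(B)\<close>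
    and condB1: "\<forall>\<^sub>F n in sequentially. \<forall>ls\<in>\<Lambda>s n. \<forall>m\<in>M n.
          \<exists>\<theta>\<in>\<Theta> n m. d n (T n \<theta>) ls \<le> \<eta> n m"
    and condB2: "\<forall>u>0. \<exists>c. \<forall>\<^sub>F n in sequentially. \<forall>ls\<in>\<Lambda>s n. \<forall>m\<in>M n. \<forall>z>\<zeta> n m.
          covering_number (u * z) {\<theta> \<in> \<Theta> n m. d n (T n \<theta>) ls \<le> 2 * z}
              (\<lambda>\<theta> \<theta>'. d n (T n \<theta>) (T n \<theta>')) \<noteq> \<infinity> \<and>
          real (the_enat (covering_number (u * z) {\<theta> \<in> \<Theta> n m. d n (T n \<theta>) ls \<le> 2 * z}
              (\<lambda>\<theta> \<theta>'. d n (T n \<theta>) (T n \<theta>'))))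
            \<le> exp (c * real n * (\<zeta> n m)\<^sup>2)"
  \<comment> \<open>(C)\<close>
    and \<epsilon>_def: "\<And>n. \<epsilon> n = (INF m\<in>M n. \<eta> n m + \<zeta> n m)"
    and condC0: "filterlim (\<lambda>n. real n * (\<epsilon> n)\<^sup>2) at_top sequentially"
    and condC: "\<exists>c1 c2 c3. c1 > 0 \<and> c2 > 0 \<and> c3 > 0 \<and>
          (\<forall>H' L'. H' > 1 \<longrightarrow> L' > 0 \<longrightarrow> (\<forall>\<^sub>F n in sequentially.
             (\<integral>\<^sup>+ m. ennreal (exp (- L' * real n * (\<zeta> n m)\<^sup>2))
                  \<partial>count_space {m \<in> M n. \<zeta> n m \<ge> H' * \<epsilon> n})
               \<le> ennreal (exp ((c1 - L' * H'\<^sup>2) * real n * (\<epsilon> n)\<^sup>2)))) \<and>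
          (\<forall>H' L''. H' > 1 \<longrightarrow> L'' > 0 \<longrightarrow> (\<forall>\<^sub>F n in sequentially.
             (\<integral>\<^sup>+ m. ennreal (exp (L'' * real n * (\<zeta> n m)\<^sup>2))
                  \<partial>count_space {m \<in> M n. \<zeta> n m < H' * \<epsilon> n})
               \<le> ennreal (exp ((c2 + c3 * L'' * H'\<^sup>2) * real n * (\<epsilon> n)\<^sup>2))))"
  \<comment> \<open>(D)\<close>
    and condD: "\<exists>c>0. \<forall>\<^sub>F n in sequentially. \<forall>ls\<in>\<Lambda>s n. \<forall>m\<in>M n.
          emeasure (\<Pi>m n m) {\<theta> \<in> space (S n). d n (T n \<theta>) ls \<le> \<eta> n m + \<zeta> n m}
            \<ge> ennreal (exp (- c * real n * (\<zeta> n m)\<^sup>2))"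
  \<comment> \<open>(E)\<close>
    and condE: "\<exists>c>0. \<forall>\<^sub>F n in sequentially. (\<Squnion>ls\<in>\<Lambda>s n.
          \<integral>\<^sup>+ y. e2ennreal (INF \<Xi>\<in>var_family (S n) (M n) (V n).
             KL_div \<Xi> (posterior (mixture (S n) (M n) (prior_weight b0 (L n) n (M n) (\<zeta> n)) (\<Pi>m n))
                                  (\<lambda>\<theta> y. q n (T n \<theta>) y) y)) \<partial>P n ls)
          \<le> ennreal (c * L n * real n * (\<epsilon> n)\<^sup>2)"
    and A_div: "filterlim A at_top sequentially"
  shows "(\<lambda>n. \<Squnion>ls\<in>\<Lambda>s n. \<integral>\<^sup>+ y. emeasure (\<Xi>hat n y)
             {\<theta> \<in> space (S n). d n (T n \<theta>) ls \<ge> A n * sqrt (L n) * \<epsilon> n} \<partial>P n ls)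
         \<longlonglongrightarrow> 0"
proof -
  obtain \<rho>0 \<rho>p a1 a2 c1 c2 where \<rho>0: "0 < \<rho>0" "\<rho>0 < 1" and \<rho>p: "\<rho>p > 1"
    and c12: "c2 \<ge> c1" "c1 > 0"
    and evA: "\<forall>\<^sub>F n in sequentially. \<forall>l0\<in>\<Lambda> n. \<forall>l1\<in>\<Lambda> n.
              ereal (a1 + c1 * real n * (d n l0 l1)\<^sup>2) \<le> renyi_div \<rho>0 (P n l0) (P n l1) \<and>
              renyi_div \<rho>p (P n l0) (P n l1) \<le> ereal (a2 + c2 * real n * (d n l0 l1)\<^sup>2)"
    using condA by blast
  have "c2 > 0" using c12 by simp
  obtain cL cS cT where cLST: "cL > 0" "cS > 0" "cT > 0"
    and evL: "\<And>H' L'. H' > 1 \<Longrightarrow> L' > 0 \<Longrightarrow> \<forall>\<^sub>F n in sequentially.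
             (\<integral>\<^sup>+ m. ennreal (exp (- L' * real n * (\<zeta> n m)\<^sup>2))
                  \<partial>count_space {m \<in> M n. \<zeta> n m \<ge> H' * \<epsilon> n})
               \<le> ennreal (exp ((cL - L' * H'\<^sup>2) * real n * (\<epsilon> n)\<^sup>2))"
    and evS: "\<And>H' L''. H' > 1 \<Longrightarrow> L'' > 0 \<Longrightarrow> \<forall>\<^sub>F n in sequentially.
             (\<integral>\<^sup>+ m. ennreal (exp (L'' * real n * (\<zeta> n m)\<^sup>2))
                  \<partial>count_space {m \<in> M n. \<zeta> n m < H' * \<epsilon> n})
               \<le> ennreal (exp ((cS + cT * L'' * H'\<^sup>2) * real n * (\<epsilon> n)\<^sup>2))"
    using condC by blast
  obtain cD where "cD > 0" and evD: "\<forall>\<^sub>F n in sequentially. \<forall>ls\<in>\<Lambda>s n. \<forall>m\<in>M n.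
          emeasure (\<Pi>m n m) {\<theta> \<in> space (S n). d n (T n \<theta>) ls \<le> \<eta> n m + \<zeta> n m}
            \<ge> ennreal (exp (- cD * real n * (\<zeta> n m)\<^sup>2))"
    using condD by blast
  define prior where "prior n = mixture (S n) (M n) (prior_weight b0 (L n) n (M n) (\<zeta> n)) (\<Pi>m n)" for n
  define post where "post n = posterior (prior n) (\<lambda>\<theta> y. q n (T n \<theta>) y)" for n
  define kl where "kl n y = (INF \<Xi>\<in>var_family (S n) (M n) (V n). KL_div \<Xi> (post n y))" for n y
  obtain cE where "cE > 0" and evE: "\<forall>\<^sub>F n in sequentially.
      (\<Squnion>ls\<in>\<Lambda>s n. \<integral>\<^sup>+ y. e2ennreal (kl n y) \<partial>P n ls) \<le> ennreal (cE * L n * real n * (\<epsilon> n)\<^sup>2)"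
    using condE unfolding kl_def post_def prior_def by blast
  define v where "v = (1 - \<rho>0) * c1 / 8"
  have v_pos: "v > 0" using \<rho>0 c12 by (simp add: v_def)
  \<comment> \<open>The bound \<open>1 / 2\<close> keeps the useful centres at distance
    \<open>z / 2\<close> from the truth; the square root makes the divergence between a parameter
    and its centre at most \<open>a2 + v / 2 * n * z\<^sup>2\<close>.\<close>
  define u where "u = min (1 / 2) (sqrt (v / (2 * c2)))"
  have u_pos: "u > 0" using v_pos \<open>c2 > 0\<close> by (simp add: u_def)
  have u_half: "u \<le> 1 / 2" by (simp add: u_def)
  have u_v: "c2 * u\<^sup>2 \<le> v / 2"
  proof -
    have "u\<^sup>2 \<le> (sqrt (v / (2 * c2)))\<^sup>2" using u_pos by (intro power_mono) (auto simp: u_def)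
    also have "\<dots> = v / (2 * c2)" using v_pos \<open>c2 > 0\<close> by simp
    finally show ?thesis using \<open>c2 > 0\<close> by (simp add: field_simps)
  qed
  obtain cu0 where evB: "\<forall>\<^sub>F n in sequentially. \<forall>ls\<in>\<Lambda>s n. \<forall>m\<in>M n. \<forall>z>\<zeta> n m.
          covering_number (u * z) {\<theta> \<in> \<Theta> n m. d n (T n \<theta>) ls \<le> 2 * z}
              (\<lambda>\<theta> \<theta>'. d n (T n \<theta>) (T n \<theta>')) \<noteq> \<infinity> \<and>
          real (the_enat (covering_number (u * z) {\<theta> \<in> \<Theta> n m. d n (T n \<theta>) ls \<le> 2 * z}
              (\<lambda>\<theta> \<theta>'. d n (T n \<theta>) (T n \<theta>'))))
            \<le> exp (cu0 * real n * (\<zeta> n m)\<^sup>2)"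
    using condB2 u_pos by blast
  \<comment> \<open>The constant from (B) comes without a sign, while (C) asks for a positive
    multiplier.\<close>
  define cu where "cu = max cu0 1"
  have cu: "cu > 0" "cu0 \<le> cu" by (auto simp: cu_def)
  define \<kappa> where "\<kappa> = min ((\<rho>p - 1) * (v / 2)) v"
  have \<kappa>_pos: "\<kappa> > 0" using v_pos \<rho>p by (simp add: \<kappa>_def)
  define C where "C = exp ((\<rho>p - 1) * a2) + exp (- (1 - \<rho>0) * a1)"
  define x where "x n = real n * (\<epsilon> n)\<^sup>2" for n
  have x_top: "filterlim x at_top sequentially" using condC0 unfolding x_def .
  define cZ where "cZ = cL + (cS + cT * 1 * 2\<^sup>2) + 1"
  define c0 where "c0 = 4 * b0 + 4 * cD + 4 * c2 + 1 + cZ"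
  \<comment> \<open>The bound for the posterior tail involves neither the truth nor
    \<open>K\<close>, \<open>G\<close> and \<open>H\<close>, so its convergence can be settled
    before \<open>e\<close> is given.\<close>
  define \<delta> where "\<delta> n = 2 * (exp ((\<rho>p - 1) * a2) * exp (- (\<rho>p - 1) * x n)) + (4 * C + 2) * exp (- x n)" for n
  have \<delta>_lim: "\<delta> \<longlonglongrightarrow> 0"
  proof -
    have exp_lim: "(\<lambda>n. exp (- k * x n)) \<longlonglongrightarrow> 0" if "k > 0" for k
      using that x_top
      by (intro filterlim_compose[OF exp_at_bot] filterlim_tendsto_neg_mult_at_bot[OF tendsto_const]) auto
    have "(\<lambda>n. 2 * (exp ((\<rho>p - 1) * a2) * exp (- (\<rho>p - 1) * x n)) + (4 * C + 2) * exp (- 1 * x n))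
        \<longlonglongrightarrow> 2 * (exp ((\<rho>p - 1) * a2) * 0) + (4 * C + 2) * 0"
      using \<rho>p by (intro tendsto_intros exp_lim) auto
    then show ?thesis unfolding \<delta>_def by simp
  qed
  have main: "\<forall>\<^sub>F n in sequentially. \<forall>ls\<in>\<Lambda>s n.
      (\<integral>\<^sup>+ y. emeasure (\<Xi>hat n y) {\<theta> \<in> space (S n). d n (T n \<theta>) ls \<ge> A n * sqrt (L n) * \<epsilon> n} \<partial>P n ls)
        \<le> ennreal e" if "e > 0" for e :: real
  proof -
    \<comment> \<open>In \<open>K * (e / 2) = cE + 1\<close> the summand \<open>cE\<close> pays for
      (E) and the \<open>1\<close> for \<open>ln 2\<close>.\<close>
    define K where "K = 2 * (cE + 1) / e"
    have K_pos: "K > 0" using \<open>cE > 0\<close> \<open>e > 0\<close> by (simp add: K_def)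
    have Ke: "K * (e / 2) = cE + 1" using \<open>e > 0\<close> by (simp add: K_def)
    \<comment> \<open>The quotient is what the large models demand; the added \<open>2\<close>
      secures \<open>G > 1\<close>, as (C) requires of a cut.\<close>
    define G where "G = sqrt ((K + c0 + cL + 4 * b0 + 1) / b0 + 2)"
    have cZ_pos: "cZ > 0" using cLST by (simp add: cZ_def)
    have c0_pos: "c0 > 0" using b0_pos \<open>cD > 0\<close> \<open>c2 > 0\<close> cZ_pos by (simp add: c0_def)
    have G2: "G\<^sup>2 = (K + c0 + cL + 4 * b0 + 1) / b0 + 2"
      unfolding G_def using K_pos c0_pos cLST b0_pos by (intro real_sqrt_pow2) simp
    have G_gt: "G > 1"
      unfolding G_def using K_pos c0_pos cLST b0_pos by (intro real_less_rsqrt) (simp add: add_pos_pos add_strict_increasing2)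
    have G_ge: "b0 * G\<^sup>2 \<ge> K + c0 + cL + 4 * b0 + 1"
    proof -
      have "b0 * ((K + c0 + cL + 4 * b0 + 1) / b0) = K + c0 + cL + 4 * b0 + 1" using b0_pos by simp
      then show ?thesis unfolding G2 using b0_pos by (subst distrib_left) linarith
    qed
    \<comment> \<open>The exponent that (C) yields at the cut \<open>G\<close> and the multiplier
      \<open>cu\<close>. It grows with \<open>G\<close>, so \<open>H\<close> is chosen only
      afterwards.\<close>
    define cS' where "cS' = cS + cT * cu * G\<^sup>2"
    have cS'_pos: "cS' > 0" using cLST cu by (simp add: cS'_def add_pos_nonneg)
    define H where "H = max G (sqrt ((K + c0 + 1 + cS') / \<kappa>))"
    have GH: "G \<le> H" by (simp add: H_def)
    have H_ge: "\<kappa> * H\<^sup>2 \<ge> K + c0 + 1 + cS'"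
    proof -
      have nn: "0 \<le> (K + c0 + 1 + cS') / \<kappa>"
        using K_pos c0_pos cS'_pos \<kappa>_pos by (intro divide_nonneg_pos) auto
      have "(sqrt ((K + c0 + 1 + cS') / \<kappa>))\<^sup>2 \<le> H\<^sup>2"
        using nn by (intro power_mono) (auto simp: H_def)
      then have "(K + c0 + 1 + cS') / \<kappa> \<le> H\<^sup>2" using nn by simp
      then show ?thesis using \<kappa>_pos by (simp add: field_simps)
    qed
    have ev_x: "\<forall>\<^sub>F n in sequentially. x n \<ge> 1"
      using x_top by (simp add: filterlim_at_top)
    have ev_A: "\<forall>\<^sub>F n in sequentially. A n \<ge> H"
      using A_div by (simp add: filterlim_at_top)
    have ev_\<delta>: "\<forall>\<^sub>F n in sequentially. \<delta> n \<le> e / 2"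
      using order_tendstoD(2)[OF \<delta>_lim, of "e / 2"] \<open>e > 0\<close> by (auto elim: eventually_mono)
    \<comment> \<open>The normalising constant is bounded with the separate cut \<open>2\<close>:
      \<open>G\<close> depends on \<open>c0\<close>, hence on \<open>cZ\<close>, so using
      \<open>G\<close> itself here would be circular.\<close>
    have evL2: "\<forall>\<^sub>F n in sequentially.
        (\<integral>\<^sup>+ m. ennreal (exp (- b0 * real n * (\<zeta> n m)\<^sup>2)) \<partial>count_space {m \<in> M n. 2 * \<epsilon> n \<le> \<zeta> n m})
          \<le> ennreal (exp ((cL - b0 * 2\<^sup>2) * real n * (\<epsilon> n)\<^sup>2))"
      by (rule evL) (use b0_pos in simp_all)
    have evS2: "\<forall>\<^sub>F n in sequentially.
        (\<integral>\<^sup>+ m. ennreal (exp (1 * real n * (\<zeta> n m)\<^sup>2)) \<partial>count_space {m \<in> M n. \<zeta> n m < 2 * \<epsilon> n})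
          \<le> ennreal (exp ((cS + cT * 1 * 2\<^sup>2) * real n * (\<epsilon> n)\<^sup>2))"
      by (rule evS) simp_all
    from evA evB evD evE ev_x ev_A ev_\<delta> evL[OF G_gt b0_pos] evS[OF G_gt cu(1)] evL2 evS2
    show ?thesis
    proof eventually_elim
      case (elim n)
      note An = elim(1) and Bn = elim(2) and Dn = elim(3) and En = elim(4) and xn = elim(5)
        and HA = elim(6) and \<delta>n = elim(7) and Ln = elim(8) and Sn = elim(9)
        and L2n = elim(10) and S2n = elim(11)
      have sum_nonneg: "0 \<le> \<eta> n k + \<zeta> n k" if "k \<in> M n" for k
        using \<eta>_pos[OF that] \<zeta>_pos[OF that] by simp
      have \<epsilon>_nonneg: "\<epsilon> n \<ge> 0"
        unfolding \<epsilon>_def[of n] by (rule cINF_greatest[OF M_nonempty sum_nonneg])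
      have "\<epsilon> n \<noteq> 0" using xn by (auto simp: x_def)
      then have \<epsilon>_pos: "\<epsilon> n > 0" using \<epsilon>_nonneg by simp
      \<comment> \<open>The infimum may not be attained; being positive, it is approached within a
        factor two by some model.\<close>
      then have "(INF m\<in>M n. \<eta> n m + \<zeta> n m) < 2 * \<epsilon> n"
        unfolding \<epsilon>_def[of n] by simp
      moreover have "bdd_below ((\<lambda>m. \<eta> n m + \<zeta> n m) ` M n)"
        using sum_nonneg by (intro bdd_belowI2[of _ 0])
      ultimately obtain m where m: "m \<in> M n" and \<eta>\<zeta>: "\<eta> n m + \<zeta> n m < 2 * \<epsilon> n"
        using M_nonempty by (subst (asm) cINF_less_iff) auto
      have \<zeta>m: "0 \<le> \<zeta> n m" "\<zeta> n m \<le> 2 * \<epsilon> n"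
        using \<eta>_pos[OF m] \<zeta>_pos[OF m] \<eta>\<zeta> by auto
      let ?Zi = "\<integral>\<^sup>+ m. ennreal (exp (- b0 * L n * real n * (\<zeta> n m)\<^sup>2)) \<partial>count_space (M n)"
      define Z where "Z = enn2real ?Zi"
      have Zi_le: "?Zi \<le> ennreal (exp (cZ * (real n * (\<epsilon> n)\<^sup>2)))"
        unfolding cZ_def
        by (rule weight_integral_total[where G = 2])
          (use L2n S2n L_ge b0_pos cLST xn in \<open>simp_all add: x_def\<close>)
      \<comment> \<open>\<open>prior_weight\<close> divides by \<open>enn2real\<close> of the sum,
        which would be \<open>0\<close> for a divergent series; finiteness makes \<open>Z\<close>
        the true normalising constant.\<close>
      then have Zi: "?Zi = ennreal Z"
        unfolding Z_def by (intro ennreal_enn2real[symmetric]) (rule le_less_trans[OF _ ennreal_less_top])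
      have Z_le: "Z \<le> exp (cZ * (real n * (\<epsilon> n)\<^sup>2))"
        unfolding Z_def using Zi_le by (intro enn2real_leI) auto
      have Z_ge: "exp (- b0 * L n * real n * (\<zeta> n m)\<^sup>2) \<le> Z"
      proof -
        have "ennreal (exp (- b0 * L n * real n * (\<zeta> n m)\<^sup>2)) \<le> ?Zi"
          using m by (rule nn_integral_ge_point)
        then have "ennreal (exp (- b0 * L n * real n * (\<zeta> n m)\<^sup>2)) \<le> ennreal Z" unfolding Zi .
        then show ?thesis by (simp add: Z_def)
      qed
      have Z_pos: "Z > 0" using Z_ge exp_gt_zero less_le_trans by blast
      let ?w = "prior_weight b0 (L n) n (M n) (\<zeta> n)"
      have w_eq: "?w k = exp (- b0 * L n * real n * (\<zeta> n k)\<^sup>2) / Z" for k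
        by (simp add: prior_weight_def Z_def)
      have w_sum: "(\<integral>\<^sup>+ k. ennreal (?w k) \<partial>count_space (M n)) = 1"
      proof -
        have "(\<integral>\<^sup>+ k. ennreal (?w k) \<partial>count_space (M n)) = ?Zi / ennreal Z"
          using Z_pos by (subst nn_integral_divide[symmetric]) (auto simp: w_eq divide_ennreal)
        then show ?thesis unfolding Zi using Z_pos by (simp add: divide_ennreal)
      qed
      interpret mixture_model "\<mu> n" "\<Lambda> n" "q n" "M n" "S n" "\<Theta> n" "T n" "\<Pi>m n" ?w
        using sigma_fin[of n] q_pos[where n=n] q_meas[where n=n] P_prob[where n=n] M_countable[of n]
          \<Theta>_sets[where n=n] T_range[where n=n] lik_meas[of n] \<Pi>m_prob[where n=n] w_sum
        by (auto simp: mixture_model_def mixture_model_axioms_def P_def)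
      show ?case
      proof
        fix ls assume ls: "ls \<in> \<Lambda>s n"
        then have l: "ls \<in> \<Lambda> n" using \<Lambda>s_sub by auto
        let ?R = "H * sqrt (L n) * \<epsilon> n"
        let ?U = "{\<theta> \<in> space (S n). ?R \<le> d n (T n \<theta>) ls}"
        have X: "L n * (real n * (\<epsilon> n)\<^sup>2) \<ge> 1"
          using mult_mono[of 1 "L n" 1 "x n"] L_ge[of n] xn by (simp add: x_def)
        let ?t = "K * (L n * (real n * (\<epsilon> n)\<^sup>2))"
        have t: "?t > 0" using K_pos X by simp
        have cover: "\<exists>F. finite F \<and> F \<subseteq> \<Theta> n k \<and> real (card F) \<le> exp (cu * real n * (\<zeta> n k)\<^sup>2) \<and>
            (\<forall>\<theta>\<in>\<Theta> n k. d n (T n \<theta>) ls \<le> 2 * z \<longrightarrow> (\<exists>c\<in>F. d n (T n c) (T n \<theta>) \<le> u * z))"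
          if k: "k \<in> M n" and z: "\<zeta> n k < z" for k z
        proof -
          let ?Sh = "{\<theta> \<in> \<Theta> n k. d n (T n \<theta>) ls \<le> 2 * z}" and ?dd = "\<lambda>\<theta> \<theta>'. d n (T n \<theta>) (T n \<theta>')"
          have cov: "covering_number (u * z) ?Sh ?dd \<noteq> \<infinity>"
            "real (the_enat (covering_number (u * z) ?Sh ?dd)) \<le> exp (cu0 * real n * (\<zeta> n k)\<^sup>2)"
            using Bn ls k z by blast+
          obtain F where F: "finite F" "F \<subseteq> ?Sh" "\<And>\<theta>. \<theta> \<in> ?Sh \<Longrightarrow> \<exists>c\<in>F. d n (T n c) (T n \<theta>) \<le> u * z"
            "card F = the_enat (covering_number (u * z) ?Sh ?dd)"
            by (rule covering_number_attained[OF cov(1)]) blast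
          have "cu0 * real n * (\<zeta> n k)\<^sup>2 \<le> cu * real n * (\<zeta> n k)\<^sup>2"
            using cu(2) by (intro mult_right_mono) auto
          then have "exp (cu0 * real n * (\<zeta> n k)\<^sup>2) \<le> exp (cu * real n * (\<zeta> n k)\<^sup>2)" by simp
          then have "real (card F) \<le> exp (cu * real n * (\<zeta> n k)\<^sup>2)"
            unfolding F(4) using cov(2) by (rule order_trans[rotated])
          then show ?thesis using F(1-3) by (intro exI[of _ F]) auto
        qed
        have large: "(\<integral>\<^sup>+ k. ennreal (exp (- b0 * L n * real n * (\<zeta> n k)\<^sup>2)) \<partial>count_space {k \<in> M n. G * \<epsilon> n \<le> \<zeta> n k})
            \<le> ennreal (exp ((cL - b0 * G\<^sup>2) * (L n * (real n * (\<epsilon> n)\<^sup>2))))"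
          by (rule weight_integral_tail[OF Ln L_ge]) (use b0_pos cLST G_gt \<epsilon>_nonneg in simp_all)
        have small: "(\<integral>\<^sup>+ k. ennreal (exp (cu * real n * (\<zeta> n k)\<^sup>2)) \<partial>count_space {k \<in> M n. \<zeta> n k < G * \<epsilon> n})
            \<le> ennreal (exp (cS' * (real n * (\<epsilon> n)\<^sup>2)))"
          using Sn unfolding cS'_def by (simp only: mult.assoc)
        have mass: "ennreal (exp (- cD * real n * (\<zeta> n m)\<^sup>2))
            \<le> emeasure (\<Pi>m n m) {\<theta> \<in> space (S n). d n (T n \<theta>) ls \<le> \<eta> n m + \<zeta> n m}"
          using Dn ls m by blast
        have lower: "ereal (a1 + c1 * real n * (d n a b)\<^sup>2)
            \<le> renyi_div \<rho>0 (density (\<mu> n) (\<lambda>y. ennreal (q n a y))) (density (\<mu> n) (\<lambda>y. ennreal (q n b y)))"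
          and upper: "renyi_div \<rho>p (density (\<mu> n) (\<lambda>y. ennreal (q n a y))) (density (\<mu> n) (\<lambda>y. ennreal (q n b y)))
            \<le> ereal (a2 + c2 * real n * (d n a b)\<^sup>2)"
          if "a \<in> \<Lambda> n" "b \<in> \<Lambda> n" for a b
          using An that unfolding P_def by blast+
        have d_nonneg: "d n a b \<ge> 0" and d_sym: "d n a b = d n b a" if "a \<in> \<Lambda> n" "b \<in> \<Lambda> n" for a b
          using metric that by blast+
        have d_triangle: "d n a c \<le> d n a b + d n b c" if "a \<in> \<Lambda> n" "b \<in> \<Lambda> n" "c \<in> \<Lambda> n" for a b c
          using metric that by blast
        have tail: "emeasure (P n ls) {y \<in> space (\<mu> n). ennreal (exp (- ?t)) < emeasure (post n y) ?U}
            \<le> ennreal (\<delta> n)"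
          unfolding P_def post_def prior_def \<delta>_def x_def
          by (rule posterior_tail_exponential[OF l d_nonneg d_triangle d_sym ball_meas \<rho>0 \<rho>p c12(2) \<open>c2 > 0\<close>
                of_nat_0_le_iff lower upper v_def u_v u_half \<kappa>_def C_def cover m \<zeta>m less_imp_le[OF \<eta>\<zeta>] mass
                w_eq Z_pos Z_le Z_ge large small less_imp_le[OF b0_pos] less_imp_le[OF \<open>cD > 0\<close>]
                less_imp_le[OF cZ_pos] less_imp_le[OF cS'_pos] less_imp_le[OF K_pos] L_ge xn[unfolded x_def]
                \<epsilon>_pos GH order.strict_trans2[OF less_trans[OF zero_less_one G_gt] GH] c0_def G_ge H_ge])
        have \<Xi>_prob: "prob_space (\<Xi>hat n y)" and \<Xi>_sets: "sets (\<Xi>hat n y) = sets (S n)"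
          and \<Xi>_KL: "KL_div (\<Xi>hat n y) (post n y) \<le> kl n y" if y: "y \<in> space (\<mu> n)" for y
        proof -
          obtain \<gamma> \<Xi> where \<Xi>: "\<Xi>hat n y = mixture (S n) (M n) \<gamma> \<Xi>"
            "(\<integral>\<^sup>+ m. ennreal (\<gamma> m) \<partial>count_space (M n)) = 1" "\<forall>m\<in>M n. \<Xi> m \<in> V n m"
            using \<Xi>hat_min[OF y] by (auto simp: var_family_def)
          show "prob_space (\<Xi>hat n y)"
            unfolding \<Xi>(1) using V_sub \<Xi>(2,3) M_countable by (intro prob_space_mixture) auto
          show "sets (\<Xi>hat n y) = sets (S n)" by (simp add: \<Xi>(1))
          show "KL_div (\<Xi>hat n y) (post n y) \<le> kl n y"
            unfolding kl_def post_def prior_def using \<Xi>hat_min[OF y] by (intro INF_greatest) auto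
        qed
        have kl_meas: "kl n \<in> borel_measurable (\<mu> n)"
          using infKL_meas[of n] unfolding kl_def[abs_def] post_def prior_def .
        have E_int: "(\<integral>\<^sup>+ y. e2ennreal (kl n y) \<partial>P n ls) \<le> ennreal (cE * L n * real n * (\<epsilon> n)\<^sup>2)"
          using En ls by (meson SUP_upper order_trans)
        have "ennreal ?t * (\<integral>\<^sup>+ y. emeasure (\<Xi>hat n y) ?U \<partial>P n ls)
            \<le> ennreal ?t * emeasure (P n ls) {y \<in> space (\<mu> n). ennreal (exp (- ?t)) < emeasure (post n y) ?U}
              + (\<integral>\<^sup>+ y. e2ennreal (kl n y) \<partial>P n ls) + ennreal (ln 2)"
          unfolding P_def post_def prior_def
          by (rule variational_transfer[OF l ball_meas less_imp_le[OF t] \<Xi>_prob \<Xi>hat_meas kl_meas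
                \<Xi>_KL[unfolded post_def prior_def]])
        also have "\<dots> \<le> ennreal ?t * ennreal (e / 2) + ennreal (cE * L n * real n * (\<epsilon> n)\<^sup>2) + ennreal (ln 2)"
          using \<delta>n by (intro add_mono mult_left_mono order_trans[OF tail] E_int ennreal_leI) auto
        also have "\<dots> = ennreal (?t * (e / 2) + cE * L n * real n * (\<epsilon> n)\<^sup>2 + ln 2)"
        proof -
          have add3: "ennreal a + ennreal b + ennreal c = ennreal (a + b + c)"
            if "0 \<le> a" "0 \<le> b" "0 \<le> c" for a b c
            using that by simp
          have "0 \<le> cE * L n * real n * (\<epsilon> n)\<^sup>2" using \<open>cE > 0\<close> L_ge[of n] by simp
          moreover have te: "0 \<le> ?t * (e / 2)" using t \<open>e > 0\<close> by simp
          moreover have "ennreal ?t * ennreal (e / 2) = ennreal (?t * (e / 2))"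
            using t \<open>e > 0\<close> by (intro ennreal_mult[symmetric]) auto
          ultimately show ?thesis by (simp only: add3 ln_ge_zero one_le_numeral)
        qed
        also have "\<dots> \<le> ennreal (?t * e)"
        proof (rule ennreal_leI)
          \<comment> \<open>One half of the budget \<open>?t * e\<close> went into
            \<open>\<delta> n\<close>; the other half covers (E) and \<open>ln 2\<close>, because
            \<open>X\<close> bounds \<open>L n * x n\<close> from below by one.\<close>
          have "?t * (e / 2) = (K * (e / 2)) * (L n * (real n * (\<epsilon> n)\<^sup>2))" by simp
          also have "\<dots> = cE * L n * real n * (\<epsilon> n)\<^sup>2 + L n * (real n * (\<epsilon> n)\<^sup>2)"
            unfolding Ke by (simp add: algebra_simps)
          finally have "?t * (e / 2) \<ge> cE * L n * real n * (\<epsilon> n)\<^sup>2 + ln 2"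
            using X ln_2_less_1 by linarith
          then show "?t * (e / 2) + cE * L n * real n * (\<epsilon> n)\<^sup>2 + ln 2 \<le> ?t * e" by simp
        qed
        also have "\<dots> = ennreal ?t * ennreal e" using t \<open>e > 0\<close> by (intro ennreal_mult) auto
        finally have U_bound: "(\<integral>\<^sup>+ y. emeasure (\<Xi>hat n y) ?U \<partial>P n ls) \<le> ennreal e"
        proof (rule ennreal_mult_le_mult_iff[THEN iffD1, rotated 2])
          show "ennreal ?t \<noteq> 0" using t unfolding ennreal_eq_0_iff by linarith
        qed simp
        have "(\<integral>\<^sup>+ y. emeasure (\<Xi>hat n y) {\<theta> \<in> space (S n). d n (T n \<theta>) ls \<ge> A n * sqrt (L n) * \<epsilon> n} \<partial>P n ls)
            \<le> (\<integral>\<^sup>+ y. emeasure (\<Xi>hat n y) ?U \<partial>P n ls)"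
        proof (rule nn_integral_mono)
          fix y assume "y \<in> space (P n ls)"
          then have y: "y \<in> space (\<mu> n)" by (simp add: P_def)
          \<comment> \<open>The diverging sequence enters only through \<open>A n \<ge> H\<close>,
            which puts the set of the claim inside \<open>?U\<close>.\<close>
          have "?R \<le> A n * sqrt (L n) * \<epsilon> n"
            using HA \<epsilon>_nonneg L_ge[of n] by (intro mult_right_mono) auto
          then show "emeasure (\<Xi>hat n y) {\<theta> \<in> space (S n). d n (T n \<theta>) ls \<ge> A n * sqrt (L n) * \<epsilon> n}
              \<le> emeasure (\<Xi>hat n y) ?U"
            using ball_meas[of n ?R ls] \<Xi>_sets[OF y] by (intro emeasure_mono) auto
        qed
        then show "(\<integral>\<^sup>+ y. emeasure (\<Xi>hat n y) {\<theta> \<in> space (S n). d n (T n \<theta>) ls \<ge> A n * sqrt (L n) * \<epsilon> n} \<partial>P n ls)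
            \<le> ennreal e" using U_bound by (rule order_trans)
      qed
    qed
  qed
  show ?thesis
  proof (rule order_tendstoI)
    fix a :: ennreal assume "0 < a"
    \<comment> \<open>The supremum over the truths preserves only a weak inequality, so
      \<open>e\<close> is taken strictly below \<open>a\<close>.\<close>
    then obtain e where e: "0 < ennreal e" "ennreal e < a"
      by (metis ennreal_cases dense top.not_eq_extremum order_less_imp_not_less)
    then have "e > 0" by simp
    from main[OF this]
    show "\<forall>\<^sub>F n in sequentially. (\<Squnion>ls\<in>\<Lambda>s n. \<integral>\<^sup>+ y. emeasure (\<Xi>hat n y)
             {\<theta> \<in> space (S n). d n (T n \<theta>) ls \<ge> A n * sqrt (L n) * \<epsilon> n} \<partial>P n ls) < a"
    proof eventually_elim
      case (elim n)
      then have "(\<Squnion>ls\<in>\<Lambda>s n. \<integral>\<^sup>+ y. emeasure (\<Xi>hat n y)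
             {\<theta> \<in> space (S n). d n (T n \<theta>) ls \<ge> A n * sqrt (L n) * \<epsilon> n} \<partial>P n ls) \<le> ennreal e"
        by (intro SUP_least) auto
      then show ?case using e(2) by (rule le_less_trans)
    qed
  qed simp
qed

end
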